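(* Let $k\in\mathbb N$ be fixed. For each integer $0<j<2k$, let $$a^j_k:=\frac{(j/k)}{\sqrt{4-(j/k)^2}}.$$ (i) For each integer $0<j<2k$, there exist an open neighborhood $U^j_k$ of $(a^j_k,0)$ in $(0,+\infty)\times(-1,1)$, some $\varepsilon>0$, and a real analytic curve $(-\varepsilon,\varepsilon)\ni t\mapsto(a^j_k(t),s^j_k(t))\in U^j_k$ with $(a^j_k(0),s^j_k(0))=(a^j_k,0)$ and $(s^j_k)'(0)>0$ such that $$f_k^{-1}(0)\cap U^j_k=(\mathcal B_{\mathrm{triv}}\cap U^j_k)\cup\{(a^j_k(t),s^j_k(t)): t\in(-\varepsilon,\varepsilon)\}.$$ (ii) For all $a>0$ with $a\neq a^j_k$ for every integer $0<j<2k$, the trivial solution $(a,0)$ is locally unique for $f_k$, i.e., there exists an open neighborhood $V_k$ of $(a,0)$ in $(0,+\infty)\times(-1,1)$ such that $f_k^{-1}(0)\cap V_k=\mathcal B_{\mathrm{triv}}\cap V_k$.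
   Context: For $a>0$, let $\mathbb S^3_a=\{(z,w)\in\mathbb C^2 : |z|^2/a^2+|w|^2=1\}$ with the metric induced from $\mathbb C^2$, on which the circle $\{1\}\times\mathsf S^1$ acts isometrically by unit complex multiplication on $w$. Let $\Omega_a$ be the orbit space $\{(z,r)\in\mathbb C\times\mathbb R: |z|^2/a^2+r^2=1,\ r\ge0\}$ (quotient map $(z,w)\mapsto(z,|w|)$) with the metric $(2\pi r)^2\check{\mathrm g}_a$, where $\check{\mathrm g}_a$ is induced from $\mathbb C\times\mathbb R$. Writing $z=a e^{i\theta}\sin\phi$, $r=\cos\phi$, $\phi\in[0,\frac\pi2]$, and $\rho(\phi)=2\pi\int_0^\phi\cos\xi\sqrt{a^2\cos^2\xi+\sin^2\xi}\,d\xi$, $L_a=\rho(\frac\pi2)$, the metric of $\Omega_a$ in polar coordinates $(\rho,\theta)$ is $d\rho^2+\varphi(\rho)^2d\theta^2$, with $\varphi(\rho)=\pi a\sin(2\phi(\rho))$, where $\phi(\rho)$ is the inverse of $\rho(\phi)$. It is smooth for $0\le\rho<L_a$ and singular at $\rho=L_a$. Let $\rho_{a,0}\in(0,L_a)$ be the value with $\phi(\rho_{a,0})=\frac\pi4$. Fix functions $\beta_a\colon(-1,1)\to(0,L_a)$, $a>0$, such that $(a,s)\mapsto\beta_a(s)$ is real analytic, $\beta_a$ is bijective, $\beta_a'(s)>0$ and $\beta_a(0)=\rho_{a,0}$. For $(a,s)\in(0,+\infty)\times(-1,1)$, let $\gamma_{a,s}(t)=(\rho_{a,s}(t),\theta_{a,s}(t))$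 be the maximal geodesic in $\Omega_a$ with $\gamma_{a,s}(0)=(\beta_a(s),0)$ and $\dot\rho_{a,s}(0)=0$, $\dot\theta_{a,s}(0)=1$; here $\theta_{a,s}$ is a continuous real-valued (lifted) angle. It is defined for all $t\in\mathbb R$, and $\gamma_{a,0}(t)=(\rho_{a,0},t)$. For $k\in\mathbb N=\{1,2,\dots\}$, let $\ell_k(a,s)>0$ be the unique number with $\theta_{a,s}(\ell_k(a,s))=k\pi$, and set $f_k(a,s)=\dot\rho_{a,s}(\ell_k(a,s))$, a real analytic function on $(0,+\infty)\times(-1,1)$ vanishing on the trivial branch $\mathcal B_{\mathrm{triv}}=\{(a,0):a>0\}$. *)

theory Defs
  imports "HOL-Analysis.Analysis"
begin

section \<open>Real analytic functions of one and of two variables\<close>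

definition real_analytic_on :: "(real \<Rightarrow> real) \<Rightarrow> real set \<Rightarrow> bool" where
  "real_analytic_on h S \<longleftrightarrow>
     (\<forall>t0\<in>S. \<exists>c :: nat \<Rightarrow> real. \<exists>r>0. \<forall>t. \<bar>t - t0\<bar> < r \<longrightarrow>
        (\<lambda>n. c n * (t - t0) ^ n) sums h t)"

text \<open>The double series is summed unconditionally, equivalently absolutely.
  Both notions are meant for open \<open>S\<close>.\<close>

definition real_analytic2_on :: "(real \<times> real \<Rightarrow> real) \<Rightarrow> (real \<times> real) set \<Rightarrow> bool" where
  "real_analytic2_on h S \<longleftrightarrow>
     (\<forall>(x0, y0)\<in>S. \<exists>c :: nat \<Rightarrow> nat \<Rightarrow> real. \<exists>r>0. \<forall>x y.
        \<bar>x - x0\<bar> < r \<and> \<bar>y - y0\<bar> < r \<longrightarrow>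
        ((\<lambda>(m, n). c m n * (x - x0) ^ m * (y - y0) ^ n) has_sum h (x, y)) UNIV)"


section \<open>Geodesics of a Riemannian metric in a coordinate chart\<close>

definition partial_deriv :: "'n \<Rightarrow> (real ^ 'n \<Rightarrow> 'b::real_normed_vector) \<Rightarrow> real ^ 'n \<Rightarrow> 'b" where
  "partial_deriv i h p = frechet_derivative h (at p) (axis i 1)"

definition christoffel ::
  "(real ^ 'n \<Rightarrow> real ^ 'n ^ 'n) \<Rightarrow> real ^ 'n \<Rightarrow> 'n \<Rightarrow> 'n \<Rightarrow> 'n \<Rightarrow> real" where
  "christoffel g p m i j =
     (1 / 2) * (\<Sum>l\<in>UNIV. matrix_inv (g p) $ m $ l *
        (partial_deriv i (\<lambda>q. g q $ j $ l) p + partial_deriv j (\<lambda>q. g q $ i $ l) p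
          - partial_deriv l (\<lambda>q. g q $ i $ j) p))"

text \<open>\<open>D\<close> is the (open) coordinate domain and \<open>I\<close> the (open) time interval.\<close>

definition geodesic_on ::
  "(real ^ 'n \<Rightarrow> real ^ 'n ^ 'n) \<Rightarrow> (real ^ 'n) set \<Rightarrow> real set \<Rightarrow> (real \<Rightarrow> real ^ 'n) \<Rightarrow> bool" where
  "geodesic_on g D I c \<longleftrightarrow>
     (\<forall>t\<in>I. c t \<in> D) \<and>
     (\<exists>v. \<forall>t\<in>I. (c has_vector_derivative v t) (at t) \<and>
        (v has_vector_derivative
           (\<chi> m. - (\<Sum>i\<in>UNIV. \<Sum>j\<in>UNIV. christoffel g (c t) m i j * v t $ i * v t $ j))) (at t))"


section \<open>The orbit space in polar coordinates\<close>

definition rho_of :: "real \<Rightarrow> real \<Rightarrow> real" where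
  "rho_of a x =
     2 * pi * integral {0..x} (\<lambda>\<xi>. cos \<xi> * sqrt (a\<^sup>2 * (cos \<xi>)\<^sup>2 + (sin \<xi>)\<^sup>2))"

definition L_len :: "real \<Rightarrow> real" where
  "L_len a = rho_of a (pi / 2)"

definition phi_of :: "real \<Rightarrow> real \<Rightarrow> real" where
  "phi_of a = the_inv_into {0..pi / 2} (rho_of a)"

definition varphi :: "real \<Rightarrow> real \<Rightarrow> real" where
  "varphi a r = pi * a * sin (2 * phi_of a r)"

definition rho_zero :: "real \<Rightarrow> real" where
  "rho_zero a = (THE r. r \<in> {0<..<L_len a} \<and> phi_of a r = pi / 4)"

definition Omega :: "real \<Rightarrow> (complex \<times> real) set" where
  "Omega a = {(z, r). (cmod z)\<^sup>2 / a\<^sup>2 + r\<^sup>2 = 1 \<and> r \<ge> 0}"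

text \<open>A vector \<open>p\<close> lists the polar coordinates: \<open>p $ 1\<close> is \<open>\<rho>\<close> and \<open>p $ 2\<close> is the lifted angle \<open>\<theta>\<close>.\<close>

definition Omega_polar :: "real \<Rightarrow> real ^ 2 \<Rightarrow> complex \<times> real" where
  "Omega_polar a p =
     (of_real (a * sin (phi_of a (p $ 1))) * cis (p $ 2), cos (phi_of a (p $ 1)))"

definition polar_domain :: "real \<Rightarrow> (real ^ 2) set" where
  "polar_domain a = {p. 0 < p $ 1 \<and> p $ 1 < L_len a}"

text \<open>The metric \<open>(2 \<pi> r)\<^sup>2\<close> times the one induced from \<open>\<complex> \<times> \<real>\<close>, pulled back to
  polar coordinates. Lemma \<open>Omega_metric_polar\<close> shows that on \<open>polar_domain a\<close> this is
  \<open>d\<rho>\<^sup>2 + varphi(\<rho>)\<^sup>2 d\<theta>\<^sup>2\<close>.\<close>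

definition Omega_metric :: "real \<Rightarrow> real ^ 2 \<Rightarrow> real ^ 2 ^ 2" where
  "Omega_metric a p =
     (\<chi> i j. (2 * pi * snd (Omega_polar a p))\<^sup>2 *
        (partial_deriv i (Omega_polar a) p \<bullet> partial_deriv j (Omega_polar a) p))"


section \<open>The function whose zeros are studied\<close>

definition ell :: "(real \<Rightarrow> real \<Rightarrow> real \<Rightarrow> real ^ 2) \<Rightarrow> nat \<Rightarrow> real \<Rightarrow> real \<Rightarrow> real" where
  "ell \<gamma> k a s = (THE t. t > 0 \<and> \<gamma> a s t $ 2 = real k * pi)"

definition f_map :: "(real \<Rightarrow> real \<Rightarrow> real \<Rightarrow> real ^ 2) \<Rightarrow> nat \<Rightarrow> real \<Rightarrow> real \<Rightarrow> real" where
  "f_map \<gamma> k a s = deriv (\<lambda>t. \<gamma> a s t $ 1) (ell \<gamma> k a s)"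

definition param_domain :: "(real \<times> real) set" where
  "param_domain = {0<..} \<times> {-1<..<1}"

definition f_zeros :: "(real \<Rightarrow> real \<Rightarrow> real \<Rightarrow> real ^ 2) \<Rightarrow> nat \<Rightarrow> (real \<times> real) set" where
  "f_zeros \<gamma> k = {(a, s) \<in> param_domain. f_map \<gamma> k a s = 0}"

definition B_triv :: "(real \<times> real) set" where
  "B_triv = {(a, 0) | a. a > 0}"

definition a_bif :: "nat \<Rightarrow> nat \<Rightarrow> real" where
  "a_bif k j = (real j / real k) / sqrt (4 - (real j / real k)\<^sup>2)"


section \<open>Basic facts about the polar coordinates\<close>

lemma speed_pos:
  assumes "a > 0"
  shows "a\<^sup>2 * (cos x)\<^sup>2 + (sin x)\<^sup>2 > (0::real)"
proof (cases "sin x = 0")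
  case True
  then have "cos x \<noteq> 0" using sin_cos_squared_add[of x] by auto
  with assms True show ?thesis by simp
next
  case False
  then show ?thesis by (simp add: add_nonneg_pos)
qed

lemma rho_of_has_derivative:
  assumes "x \<in> {0..pi / 2}"
  shows "(rho_of a has_real_derivative
            2 * pi * (cos x * sqrt (a\<^sup>2 * (cos x)\<^sup>2 + (sin x)\<^sup>2))) (at x within {0..pi / 2})"
  unfolding rho_of_def
  by (intro DERIV_cmult integral_has_real_derivative continuous_intros assms)

lemma rho_of_strict_mono:
  assumes "a > 0"
  shows "strict_mono_on {0..pi / 2} (rho_of a)"
proof (rule strict_mono_onI)
  fix x y :: real
  assume xy: "x \<in> {0..pi / 2}" "y \<in> {0..pi / 2}" "x < y"
  have c: "continuous_on {x..y} (rho_of a)"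
  proof (rule continuous_on_subset)
    show "continuous_on {0..pi / 2} (rho_of a)"
      using DERIV_continuous[OF rho_of_has_derivative] by (auto simp: continuous_on_eq_continuous_within)
    show "{x..y} \<subseteq> {0..pi / 2}" using xy by auto
  qed
  show "rho_of a x < rho_of a y"
  proof (rule DERIV_pos_imp_increasing_open[OF xy(3) _ c])
    fix z assume z: "x < z" "z < y"
    then have zi: "0 < z" "z < pi / 2" using xy by auto
    have "at z within {0..pi / 2} = at z"
      using zi by (intro at_within_interior) simp
    then have "DERIV (rho_of a) z :> 2 * pi * (cos z * sqrt (a\<^sup>2 * (cos z)\<^sup>2 + (sin z)\<^sup>2))"
      using rho_of_has_derivative[of z a] zi by simp
    moreover have "0 < 2 * pi * (cos z * sqrt (a\<^sup>2 * (cos z)\<^sup>2 + (sin z)\<^sup>2))"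
      using zi speed_pos[OF assms, of z] by (simp add: cos_gt_zero)
    ultimately show "\<exists>D. DERIV (rho_of a) z :> D \<and> 0 < D" by blast
  qed
qed

lemma rho_of_0 [simp]: "rho_of a 0 = 0"
  by (simp add: rho_of_def)

lemma phi_of_rho_of:
  assumes "a > 0" "x \<in> {0..pi / 2}"
  shows "phi_of a (rho_of a x) = x"
  unfolding phi_of_def using assms rho_of_strict_mono
  by (intro the_inv_into_f_f) (auto intro: strict_mono_on_imp_inj_on)

lemma polar_angle_exists:
  assumes "a > 0" "0 < r" "r < L_len a"
  obtains x where "0 < x" "x < pi / 2" "rho_of a x = r" "phi_of a r = x"
proof -
  have c: "continuous_on {0..pi / 2} (rho_of a)"
    using DERIV_continuous[OF rho_of_has_derivative] by (auto simp: continuous_on_eq_continuous_within)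
  obtain x where x: "0 \<le> x" "x \<le> pi / 2" "rho_of a x = r"
    using IVT'[of "rho_of a" 0 r "pi / 2", OF _ _ _ c] assms by (auto simp: L_len_def)
  moreover have "x \<noteq> 0" using x assms by auto
  moreover have "x \<noteq> pi / 2" using x(3) assms(3) unfolding L_len_def by (metis less_irrefl)
  ultimately show ?thesis using that[of x] phi_of_rho_of[of a x] assms by auto
qed

lemma rho_zero_eq:
  assumes "a > 0"
  shows "rho_zero a = rho_of a (pi / 4)"
  unfolding rho_zero_def
proof (rule the_equality)
  have "rho_of a 0 < rho_of a (pi / 4)" "rho_of a (pi / 4) < rho_of a (pi / 2)"
    by (rule strict_mono_onD[OF rho_of_strict_mono[OF assms]]; simp)+
  then show "rho_of a (pi / 4) \<in> {0<..<L_len a} \<and> phi_of a (rho_of a (pi / 4)) = pi / 4"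
    by (auto simp: L_len_def phi_of_rho_of[OF assms])
next
  fix r assume r: "r \<in> {0<..<L_len a} \<and> phi_of a r = pi / 4"
  then obtain x where "rho_of a x = r" "phi_of a r = x"
    using polar_angle_exists[OF assms, of r] by (metis greaterThanLessThan_iff)
  with r show "r = rho_of a (pi / 4)" by metis
qed

lemma phi_of_has_derivative:
  assumes "a > 0" "0 < r" "r < L_len a"
  shows "(phi_of a has_real_derivative
            1 / (2 * pi * (cos (phi_of a r) *
              sqrt (a\<^sup>2 * (cos (phi_of a r))\<^sup>2 + (sin (phi_of a r))\<^sup>2)))) (at r)"
proof -
  obtain x where x: "0 < x" "x < pi / 2" "rho_of a x = r" "phi_of a r = x"
    using polar_angle_exists[OF assms] .
  let ?d = "2 * pi * (cos x * sqrt (a\<^sup>2 * (cos x)\<^sup>2 + (sin x)\<^sup>2))"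
  have d: "?d \<noteq> 0"
    using x speed_pos[OF assms(1), of x] cos_gt_zero[of x] by auto
  have "at x within {0..pi / 2} = at x"
    using x by (intro at_within_interior) simp
  then have der: "DERIV (rho_of a) x :> ?d"
    using rho_of_has_derivative[of x a] x by simp
  have c: "continuous_on {0<..<pi / 2} (rho_of a)"
  proof (rule continuous_on_subset)
    show "continuous_on {0..pi / 2} (rho_of a)"
      using DERIV_continuous[OF rho_of_has_derivative] by (auto simp: continuous_on_eq_continuous_within)
  qed auto
  have "(phi_of a has_derivative (*) (1 / ?d)) (at (rho_of a x))"
  proof (rule has_derivative_inverse_strong[of "{0<..<pi / 2}" x])
    show "(rho_of a has_derivative (*) ?d) (at x)"
      using der by (simp add: has_field_derivative_def)
    show "(*) ?d \<circ> (*) (1 / ?d) = id" using d by (auto simp: fun_eq_iff)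
  qed (use x c phi_of_rho_of[OF assms(1)] in auto)
  then show ?thesis unfolding has_field_derivative_def x(3,4) .
qed

lemma Omega_polar_in_Omega:
  assumes "a > 0" "p \<in> polar_domain a"
  shows "Omega_polar a p \<in> Omega a"
proof -
  obtain x where x: "0 < x" "x < pi / 2" "phi_of a (p $ 1) = x"
    using polar_angle_exists[of a "p $ 1"] assms by (auto simp: polar_domain_def)
  have "(cmod (of_real (a * sin x) * cis (p $ 2)))\<^sup>2 = a\<^sup>2 * (sin x)\<^sup>2"
    by (simp add: norm_mult power_mult_distrib)
  then show ?thesis
    using x assms(1) cos_gt_zero[of x] by (simp add: Omega_def Omega_polar_def)
qed

lemma Omega_metric_polar:
  assumes a: "a > 0" and p: "p \<in> polar_domain a"
  shows "Omega_metric a p $ 1 $ 1 = 1" "Omega_metric a p $ 1 $ 2 = 0"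
    "Omega_metric a p $ 2 $ 1 = 0" "Omega_metric a p $ 2 $ 2 = (varphi a (p $ 1))\<^sup>2"
proof -
  define x where "x = phi_of a (p $ 1)"
  define q where "q = sqrt (a\<^sup>2 * (cos x)\<^sup>2 + (sin x)\<^sup>2)"
  define d where "d = 1 / (2 * pi * (cos x * q))"
  define th where "th = p $ 2"
  have x: "0 < x" "x < pi / 2"
    using polar_angle_exists[of a "p $ 1"] a p by (auto simp: polar_domain_def x_def)
  have c: "cos x > 0" using x by (simp add: cos_gt_zero)
  have q: "q > 0" "q\<^sup>2 = a\<^sup>2 * (cos x)\<^sup>2 + (sin x)\<^sup>2"
    using speed_pos[OF a, of x] by (auto simp: q_def)
  have dphi: "(phi_of a has_derivative (\<lambda>h. d * h)) (at (p $ 1))"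
    using phi_of_has_derivative[OF a, of "p $ 1"] p
    unfolding x_def q_def d_def has_field_derivative_def polar_domain_def by blast
  have dphi': "((\<lambda>p. phi_of a (p $ 1)) has_derivative (\<lambda>h. d * (h $ 1))) (at p)"
    by (rule has_derivative_compose[OF bounded_linear_imp_has_derivative[OF bounded_linear_vec_nth] dphi])
  have dcis: "((\<lambda>p::real^2. cis (p $ 2)) has_derivative (\<lambda>h. (h $ 2) *\<^sub>R (\<i> * cis th))) (at p)"
    unfolding th_def
    by (rule has_derivative_cis[OF bounded_linear_imp_has_derivative[OF bounded_linear_vec_nth]])
  have D: "(Omega_polar a has_derivative
      (\<lambda>h. (of_real (a * (cos x * (d * h $ 1))) * cis th
              + of_real (a * sin x) * ((h $ 2) *\<^sub>R (\<i> * cis th)),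
            - sin x * (d * h $ 1)))) (at p)"
  proof -
    have 1: "((\<lambda>p. a * sin (phi_of a (p $ 1))) has_derivative (\<lambda>h. a * (cos x * (d * h $ 1)))) (at p)"
      by (rule has_derivative_mult_right, rule has_derivative_eq_rhs[OF has_derivative_sin[OF dphi']])
         (simp add: fun_eq_iff x_def)
    have 2: "((\<lambda>p. cos (phi_of a (p $ 1))) has_derivative (\<lambda>h. - sin x * (d * h $ 1))) (at p)"
      by (rule has_derivative_eq_rhs[OF has_derivative_cos[OF dphi']]) (simp add: fun_eq_iff x_def)
    have "((\<lambda>p. (of_real (a * sin (phi_of a (p $ 1))) * cis (p $ 2), cos (phi_of a (p $ 1))))
        has_derivative (\<lambda>h. (of_real (a * sin x) * ((h $ 2) *\<^sub>R (\<i> * cis th))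
          + of_real (a * (cos x * (d * h $ 1))) * cis th, - sin x * (d * h $ 1)))) (at p)"
      using has_derivative_Pair[OF has_derivative_mult[OF has_derivative_of_real[OF 1] dcis] 2]
      unfolding x_def th_def .
    moreover have "(\<lambda>p. (of_real (a * sin (phi_of a (p $ 1))) * cis (p $ 2), cos (phi_of a (p $ 1))))
        = Omega_polar a"
      by (simp add: fun_eq_iff Omega_polar_def)
    ultimately show ?thesis by (simp only: add.commute)
  qed
  have pd: "partial_deriv 1 (Omega_polar a) p =
        (of_real (a * (cos x * d)) * cis th, - sin x * d)"
      "partial_deriv 2 (Omega_polar a) p = (of_real (a * sin x) * (\<i> * cis th), 0)"
    by (simp_all add: partial_deriv_def frechet_derivative_at[OF D, symmetric] axis_def)
  have s: "snd (Omega_polar a p) = cos x" by (simp add: Omega_polar_def x_def)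
  have tt: "cos th * cos th + sin th * sin th = 1"
    using sin_cos_squared_add3[of th] by simp
  have i11: "partial_deriv 1 (Omega_polar a) p \<bullet> partial_deriv 1 (Omega_polar a) p = d\<^sup>2 * q\<^sup>2"
  proof -
    have "partial_deriv 1 (Omega_polar a) p \<bullet> partial_deriv 1 (Omega_polar a) p =
      (a * (cos x * d))\<^sup>2 * (cos th * cos th + sin th * sin th) + (sin x * d)\<^sup>2"
      by (simp add: pd inner_complex_def power2_eq_square algebra_simps del: sin_cos_squared_add3)
    then show ?thesis unfolding tt q(2) by (simp add: power_mult_distrib algebra_simps)
  qed
  have i12: "partial_deriv 1 (Omega_polar a) p \<bullet> partial_deriv 2 (Omega_polar a) p = 0"
    by (simp add: pd inner_complex_def)
  have i22: "partial_deriv 2 (Omega_polar a) p \<bullet> partial_deriv 2 (Omega_polar a) p = (a * sin x)\<^sup>2"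
  proof -
    have "partial_deriv 2 (Omega_polar a) p \<bullet> partial_deriv 2 (Omega_polar a) p =
      (a * sin x)\<^sup>2 * (cos th * cos th + sin th * sin th)"
      by (simp add: pd inner_complex_def power2_eq_square algebra_simps del: sin_cos_squared_add3)
    then show ?thesis unfolding tt by simp
  qed
  have "(2 * pi * cos x)\<^sup>2 * (d\<^sup>2 * q\<^sup>2) = (2 * pi * cos x * d * q)\<^sup>2"
    by (simp add: power_mult_distrib)
  also have "2 * pi * cos x * d * q = 1"
    using c q(1) by (simp add: d_def)
  finally show "Omega_metric a p $ 1 $ 1 = 1"
    by (simp add: Omega_metric_def s i11)
  show "Omega_metric a p $ 1 $ 2 = 0" "Omega_metric a p $ 2 $ 1 = 0"
    using i12 by (simp_all add: Omega_metric_def inner_commute)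
  show "Omega_metric a p $ 2 $ 2 = (varphi a (p $ 1))\<^sup>2"
    unfolding varphi_def x_def[symmetric] sin_double
    by (simp add: Omega_metric_def s i22 power_mult_distrib)
qed

end

theory Submission
  imports Defs "HOL-Complex_Analysis.Cauchy_Integral_Formula"
begin

text \<open>
  Write \<open>x = phi_of a \<rho>\<close> along a geodesic starting at a turning point and \<open>m = cos (2 x(0))\<close>.
  By Clairaut's relation and conservation of energy, \<open>cos (2 x) = m cos \<psi>\<close> for a phase \<open>\<psi>\<close> with
  \<open>\<rho>'\<close> proportional to \<open>sin \<psi>\<close>, and \<open>\<theta>\<close> is an explicit increasing function of \<open>\<psi>\<close>. Hence, for
  \<open>m \<noteq> 0\<close>, \<open>f\<^sub>k(a, s)\<close> vanishes iff \<open>k \<pi>\<close> is an integer multiple \<open>j \<Theta>(a, m)\<close> of the angle \<open>\<Theta>\<close> swept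
  between consecutive turning points. Since \<open>\<Theta>(a, 0) = \<pi> sqrt (1 + a\<^sup>2) / (2 a)\<close> is strictly
  decreasing in \<open>a\<close> and equals \<open>k \<pi> / j\<close> exactly at \<open>a_bif k j\<close>, the bifurcating branch is the graph
  \<open>a = A(s)\<close> solving \<open>\<Theta> = k \<pi> / j\<close>. Analyticity of \<open>A\<close> follows by extending everything to
  complex arguments, where the inverse function theorem yields holomorphic solutions.
\<close>

section \<open>Holomorphic functions of two complex variables\<close>

text \<open>At \<open>(a_bif k j, 0)\<close> two branches of zeros of \<open>f_k\<close> cross, so
  the implicit function theorem cannot be applied to \<open>f_k\<close> itself; the trivial branch
  has to be split off. The angle \<Theta> does this. It keeps a meaning at \<open>m = 0\<close>,
  where there are no isolated turning points: its value there is the limit for small oscillations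
  about the circle at angle pi/4. That the second branch is a curve then rests only on the
  derivative of \<Theta>(a, 0) in \<open>a\<close> being nonzero. Since k pi / \<Theta> is
  continuous, no integer other than \<open>j\<close> is attained near such a point, and none at all
  near the remaining points (a, 0). Complex arguments enter because two functions are given only
  implicitly: \<open>phi_of\<close>, the inverse of \<open>rho_of\<close>, and the branch
  \<open>A\<close>. A local inverse of a map with complex linear derivatives again has complex
  linear derivatives, so the inverse function theorem for differentiable maps already yields power
  series. The geodesic flow is never extended, only \<beta> and the integrals behind
  \<open>rho_of\<close> and \<Theta>.\<close>

lemma continuous_on_deriv_param:
  fixes f :: "complex \<Rightarrow> 'b::t2_space \<Rightarrow> complex"
  assumes S: "open S" and c: "continuous_on (S \<times> T) (\<lambda>(z, t). f z t)"
    and h: "\<And>t. t \<in> T \<Longrightarrow> (\<lambda>z. f z t) holomorphic_on S"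
  shows "continuous_on (S \<times> T) (\<lambda>(z, t). deriv (\<lambda>z. f z t) z)"
proof -
  have "continuous (at (z0, t0) within S \<times> T) (\<lambda>(z, t). deriv (\<lambda>z. f z t) z)"
    if z0: "z0 \<in> S" and t0: "t0 \<in> T" for z0 t0
  proof -
    obtain r where r: "r > 0" "cball z0 r \<subseteq> S"
      using S z0 open_contains_cball by blast
    \<comment> \<open>Cauchy's integral for the derivative, without its factor 1 / (2 pi i). The
      circle stays fixed while \<open>w\<close> moves inside it, so the integrand is jointly
      continuous and the integral inherits this.\<close>
    define I where "I = (\<lambda>(w, t). integral (cbox 0 1) (\<lambda>x. f (circlepath z0 r x) t
        / (circlepath z0 r x - w)\<^sup>2 * (2 * pi * \<i> * r * exp (2 * of_real pi * \<i> * x))))"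
    have circ: "circlepath z0 r x \<in> sphere z0 r" for x
      using r(1) by (auto simp: circlepath dist_norm norm_mult)
    have circ_c: "continuous_on X (circlepath z0 r)" for X
      by (auto simp: circlepath intro!: continuous_intros)
    have cI: "continuous_on (ball z0 r \<times> T) I"
      unfolding I_def case_prod_beta
    proof (rule integral_continuous_on_param)
      have 1: "continuous_on ((ball z0 r \<times> T) \<times> cbox 0 1) (\<lambda>q. f (circlepath z0 r (snd q)) (snd (fst q)))"
      proof -
        have "continuous_on ((ball z0 r \<times> T) \<times> cbox 0 1)
           (\<lambda>q. (case (circlepath z0 r (snd q), snd (fst q)) of (z, t) \<Rightarrow> f z t))"
          apply (rule continuous_on_compose2[OF c])
           apply (intro continuous_intros continuous_on_compose2[OF circ_c[of UNIV]])
             apply auto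
          using circ r by (meson in_mono sphere_cball)
        then show ?thesis by simp
      qed
      show "continuous_on ((ball z0 r \<times> T) \<times> cbox 0 1)
         (\<lambda>(x, t). f (circlepath z0 r t) (snd x) / (circlepath z0 r t - fst x)\<^sup>2 *
            (2 * pi * \<i> * r * exp (2 * of_real pi * \<i> * t)))"
        unfolding case_prod_beta
        apply (intro continuous_intros 1 continuous_on_compose2[OF circ_c[of UNIV]])
        using circ by (auto simp: dist_norm)
    qed
    have eq: "deriv (\<lambda>z. f z t) w = 1 / (2 * of_real pi * \<i>) * I (w, t)"
      if "w \<in> ball z0 r" "t \<in> T" for w t
    proof -
      have "(\<lambda>z. f z t) holomorphic_on cball z0 r"
        using h[OF that(2)] r(2) holomorphic_on_subset by blast
      then have "continuous_on (cball z0 r) (\<lambda>z. f z t)" "(\<lambda>z. f z t) holomorphic_on ball z0 r"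
        using holomorphic_on_imp_continuous_on holomorphic_on_subset ball_subset_cball by blast+
      from DERIV_imp_deriv[OF Cauchy_derivative_integral_circlepath(2)[OF this that(1)]]
      show ?thesis
        by (simp add: contour_integral_integral I_def vector_derivative_circlepath)
    qed
    have "continuous_on (ball z0 r \<times> T) (\<lambda>(z, t). deriv (\<lambda>z. f z t) z)"
    proof -
      have "continuous_on (ball z0 r \<times> T) (\<lambda>q. 1 / (2 * of_real pi * \<i>) * I q)"
        by (intro continuous_intros cI)
      then show ?thesis by (rule continuous_on_eq) (auto simp: eq)
    qed
    then have "continuous (at (z0, t0) within ball z0 r \<times> T) (\<lambda>(z, t). deriv (\<lambda>z. f z t) z)"
      using r t0 by (simp add: continuous_on_eq_continuous_within)
    moreover have "at (z0, t0) within S \<times> T = at (z0, t0) within ball z0 r \<times> T"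
      using r ball_subset_cball[of z0 r]
      by (intro at_within_nhd[of _ "ball z0 r \<times> UNIV"]) (auto intro: open_Times)
    ultimately show ?thesis by simp
  qed
  then show ?thesis by (auto simp: continuous_on_eq_continuous_within)
qed

text \<open>Differentiation under the integral sign. The Leibniz rule asks for a jointly continuous
  derivative of the integrand, which Cauchy's formula supplies from joint continuity of the
  integrand itself.\<close>

lemma holomorphic_on_integral_param:
  fixes f :: "complex \<Rightarrow> real \<Rightarrow> complex"
  assumes S: "open S" and c: "continuous_on (S \<times> {a..b}) (\<lambda>(z, t). f z t)"
    and h: "\<And>t. t \<in> {a..b} \<Longrightarrow> (\<lambda>z. f z t) holomorphic_on S"
  shows "(\<lambda>z. integral {a..b} (f z)) holomorphic_on S"
  unfolding holomorphic_on_open[OF S]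
proof (intro ballI)
  fix z assume z: "z \<in> S"
  obtain r where r: "r > 0" "ball z r \<subseteq> S"
    using S z open_contains_ball by blast
  have "((\<lambda>z. integral (cbox a b) (f z)) has_field_derivative
     integral (cbox a b) (\<lambda>t. deriv (\<lambda>z. f z t) z)) (at z within ball z r)"
  proof (rule leibniz_rule_field_derivative)
    show "((\<lambda>x. f x t) has_field_derivative deriv (\<lambda>z. f z t) x) (at x within ball z r)"
      if "x \<in> ball z r" "t \<in> cbox a b" for x t
      using that r h[of t] holomorphic_derivI[OF h S, of t x] by (auto intro: has_field_derivative_at_within)
    show "f x integrable_on cbox a b" if "x \<in> ball z r" for x
    proof (rule integrable_continuous)
      have "continuous_on (cbox a b) (\<lambda>t. (case (x, t) of (z, t) \<Rightarrow> f z t))"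
        by (rule continuous_on_compose2[OF c]) (use that r in \<open>auto intro!: continuous_intros\<close>)
      then show "continuous_on (cbox a b) (f x)" by simp
    qed
    show "continuous_on (ball z r \<times> cbox a b) (\<lambda>(x, t). deriv (\<lambda>z. f z t) x)"
      by (rule continuous_on_subset[OF continuous_on_deriv_param[OF S c h]]) (use r in auto)
  qed (use r in auto)
  then show "\<exists>f'. ((\<lambda>z. integral {a..b} (f z)) has_field_derivative f') (at z)"
    using at_within_open[of z "ball z r"] r by auto
qed

text \<open>Asking for a complex linear Frechet derivative, instead of separate holomorphy, reduces
  composition to the chain rule; \<open>holo2I_separately\<close> is Osgood's lemma relating the two.\<close>

definition holo2 :: "(complex \<times> complex \<Rightarrow> complex) \<Rightarrow> (complex \<times> complex) set \<Rightarrow> bool" where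
  "holo2 G W \<longleftrightarrow> (\<forall>p\<in>W. \<exists>A B. (G has_derivative (\<lambda>h. A * fst h + B * snd h)) (at p))"

lemma holo2_subset: "holo2 G W \<Longrightarrow> V \<subseteq> W \<Longrightarrow> holo2 G V"
  by (auto simp: holo2_def)

lemma holo2_imp_continuous_on: "holo2 G W \<Longrightarrow> continuous_on W G"
  unfolding holo2_def by (meson continuous_at_imp_continuous_on has_derivative_continuous)

lemma has_derivative_imp_partial_derivs:
  assumes "(G has_derivative (\<lambda>h. A * fst h + B * snd h)) (at (z, w))"
  shows "((\<lambda>x. G (x, w)) has_field_derivative A) (at z)"
    and "((\<lambda>y. G (z, y)) has_field_derivative (B :: complex)) (at w)"
proof -
  have "((\<lambda>x. (x, w)) has_derivative (\<lambda>h. (h, 0))) (at z)"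
    by (intro has_derivative_Pair has_derivative_ident has_derivative_const)
  from has_derivative_compose[OF this assms]
  show "((\<lambda>x. G (x, w)) has_field_derivative A) (at z)"
    by (simp add: has_field_derivative_def)
  have "((\<lambda>y. (z, y)) has_derivative (\<lambda>h. (0, h))) (at w)"
    by (intro has_derivative_Pair has_derivative_ident has_derivative_const)
  from has_derivative_compose[OF this assms]
  show "((\<lambda>y. G (z, y)) has_field_derivative B) (at w)"
    by (simp add: has_field_derivative_def)
qed

lemma holo2_has_derivative:
  assumes "holo2 G W" "(z, w) \<in> W"
  shows "(G has_derivative (\<lambda>h. deriv (\<lambda>x. G (x, w)) z * fst h + deriv (\<lambda>y. G (z, y)) w * snd h)) (at (z, w))"
proof -
  obtain A B where AB: "(G has_derivative (\<lambda>h. A * fst h + B * snd h)) (at (z, w))"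
    using assms by (auto simp: holo2_def)
  with has_derivative_imp_partial_derivs[OF AB] show ?thesis
    by (simp add: DERIV_imp_deriv)
qed

lemma partial_derivs_continuous:
  fixes G :: "complex \<times> complex \<Rightarrow> complex"
  assumes W: "open W" and c: "continuous_on W G"
    and 1: "\<And>z w. (z, w) \<in> W \<Longrightarrow> (\<lambda>x. G (x, w)) field_differentiable (at z)"
  shows "continuous_on W (\<lambda>(z, w). deriv (\<lambda>x. G (x, w)) z)"
proof -
  have "continuous (at p) (\<lambda>(z, w). deriv (\<lambda>x. G (x, w)) z)" if p: "p \<in> W" for p
  proof -
    obtain A B where AB: "open A" "open B" "p \<in> A \<times> B" "A \<times> B \<subseteq> W"
      using p W open_prod_elim by metis
    have "continuous_on (A \<times> B) (\<lambda>(z, w). deriv (\<lambda>x. G (x, w)) z)"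
    proof (rule continuous_on_deriv_param[OF AB(1)])
      show "continuous_on (A \<times> B) (\<lambda>(z, t). G (z, t))"
        using continuous_on_subset[OF c AB(4)] by simp
      show "(\<lambda>z. G (z, t)) holomorphic_on A" if "t \<in> B" for t
        unfolding holomorphic_on_def
        by (rule ballI, rule field_differentiable_at_within, rule 1) (use AB(4) that in blast)
    qed
    then show ?thesis
      using AB(3) continuous_on_eq_continuous_at[OF open_Times[OF AB(1,2)]] by blast
  qed
  then show ?thesis by (simp add: continuous_at_imp_continuous_on)
qed

lemma partial_derivs_continuous':
  fixes G :: "complex \<times> complex \<Rightarrow> complex"
  assumes W: "open W" and c: "continuous_on W G"
    and 2: "\<And>z w. (z, w) \<in> W \<Longrightarrow> (\<lambda>y. G (z, y)) field_differentiable (at w)"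
  shows "continuous_on W (\<lambda>(z, w). deriv (\<lambda>y. G (z, y)) w)"
proof -
  let ?W = "prod.swap -` W"
  have o: "open ?W"
    by (intro open_vimage W continuous_on_swap)
  have "continuous_on ?W (\<lambda>(w, z). deriv (\<lambda>y. (G \<circ> prod.swap) (y, z)) w)"
  proof (rule partial_derivs_continuous[OF o])
    show "continuous_on ?W (G \<circ> prod.swap)"
      by (intro continuous_on_compose continuous_on_swap continuous_on_subset[OF c]) auto
  qed (use 2 in auto)
  then have "continuous_on W ((\<lambda>(w, z). deriv (\<lambda>y. (G \<circ> prod.swap) (y, z)) w) \<circ> prod.swap)"
    by (intro continuous_on_compose continuous_on_swap) (auto elim: continuous_on_subset)
  then show ?thesis by (simp add: o_def case_prod_beta)
qed

lemma holo2I_separately: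
  assumes W: "open W" and c: "continuous_on W G"
    and 1: "\<And>z w. (z, w) \<in> W \<Longrightarrow> (\<lambda>x. G (x, w)) field_differentiable (at z)"
    and 2: "\<And>z w. (z, w) \<in> W \<Longrightarrow> (\<lambda>y. G (z, y)) field_differentiable (at w)"
  shows "holo2 G W"
  unfolding holo2_def
proof
  fix p assume p: "p \<in> W"
  obtain z w where zw: "p = (z, w)" by force
  obtain A B where AB: "open A" "open B" "p \<in> A \<times> B" "A \<times> B \<subseteq> W"
    using p W open_prod_elim by metis
  \<comment> \<open>The criterion for total differentiability wants a convex second factor, hence
    the ball, one partial derivative at the point, and continuity of the other partial
    derivative.\<close>
  obtain r where r: "r > 0" "ball w r \<subseteq> B" using AB zw open_contains_ball by blast
  have c2: "continuous_on W (\<lambda>(z, w). deriv (\<lambda>y. G (z, y)) w)"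
    by (rule partial_derivs_continuous'[OF W c 2])
  have "((\<lambda>(x, y). G (x, y)) has_derivative
     (\<lambda>(tx, ty). deriv (\<lambda>x. G (x, w)) z * tx + blinfun_mult_right (deriv (\<lambda>y. G (z, y)) w) ty))
       (at (z, w) within A \<times> ball w r)"
  proof (rule has_derivative_partialsI)
    show "((\<lambda>x. G (x, w)) has_derivative (\<lambda>tx. deriv (\<lambda>x. G (x, w)) z * tx)) (at z within A)"
      using 1[of z w] p zw by (metis DERIV_deriv_iff_field_differentiable has_derivative_at_withinI has_field_derivative_def)
    show "((\<lambda>y. G (x, y)) has_derivative blinfun_apply (blinfun_mult_right (deriv (\<lambda>y. G (x, y)) y))) (at y within ball w r)"
      if "x \<in> A" "y \<in> ball w r" for x y
    proof -
      have "(x, y) \<in> W" using that AB r by auto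
      from 2[OF this] show ?thesis
        by (metis DERIV_deriv_iff_field_differentiable has_derivative_at_withinI has_field_derivative_def blinfun_mult_right.rep_eq)
    qed
    have "continuous (at (z, w)) (\<lambda>(x, y). deriv (\<lambda>y. G (x, y)) y)"
      using c2 W p zw by (simp add: continuous_on_eq_continuous_at)
    then have "continuous (at (z, w) within A \<times> ball w r) (\<lambda>q. case q of (x, y) \<Rightarrow> deriv (\<lambda>y. G (x, y)) y)"
      by (rule continuous_at_imp_continuous_at_within)
    from bounded_linear.continuous[OF bounded_linear_blinfun_mult_right this]
    show "continuous (at (z, w) within A \<times> ball w r) (\<lambda>(x, y). blinfun_mult_right (deriv (\<lambda>y. G (x, y)) y))"
      by (simp add: case_prod_unfold)
  qed (use r in auto)
  moreover have "at (z, w) within A \<times> ball w r = at (z, w)"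
    using AB r zw by (intro at_within_open) (auto intro: open_Times)
  ultimately show "\<exists>A B. (G has_derivative (\<lambda>h. A * fst h + B * snd h)) (at p)"
    unfolding zw by (auto simp: case_prod_unfold)
qed

text \<open>The inverse function theorem for (z, w) \<mapsto> (G (z, w), w), whose derivative is
  triangular and hence invertible as soon as the partial derivative in \<open>z\<close> is nonzero.
  The inverse leaves \<open>w\<close> alone, so its first component \<open>g\<close> carries all the
  information.\<close>

lemma holo2_inverse:
  assumes G: "holo2 G W" and W: "open W" and p: "(z0, w0) \<in> W"
    and nz: "deriv (\<lambda>z. G (z, w0)) z0 \<noteq> 0"
  obtains U V g where "open U" "U \<subseteq> W" "(z0, w0) \<in> U" "open V" "(G (z0, w0), w0) \<in> V" "holo2 g V"
    "\<And>z w. (z, w) \<in> U \<Longrightarrow> (G (z, w), w) \<in> V \<and> g (G (z, w), w) = z"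
    "\<And>v w. (v, w) \<in> V \<Longrightarrow> (g (v, w), w) \<in> U \<and> G (g (v, w), w) = v"
proof -
  define F where "F = (\<lambda>p. (G p, snd p))"
  define Gx where "Gx = (\<lambda>(z, w). deriv (\<lambda>x. G (x, w)) z)"
  define Gy where "Gy = (\<lambda>(z, w). deriv (\<lambda>y. G (z, y)) w)"
  have dG: "(G has_derivative (\<lambda>h. Gx p * fst h + Gy p * snd h)) (at p)" if "p \<in> W" for p
    using holo2_has_derivative[OF G, of "fst p" "snd p"] that by (simp add: Gx_def Gy_def case_prod_beta)
  have cG: "continuous_on W G" by (rule holo2_imp_continuous_on[OF G])
  have cx: "continuous_on W Gx" unfolding Gx_def
    by (rule partial_derivs_continuous[OF W cG])
      (use holo2_has_derivative[OF G, THEN has_derivative_imp_partial_derivs(1)] in \<open>auto simp: field_differentiable_def\<close>)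
  have cy: "continuous_on W Gy" unfolding Gy_def
    by (rule partial_derivs_continuous'[OF W cG])
      (use holo2_has_derivative[OF G, THEN has_derivative_imp_partial_derivs(2)] in \<open>auto simp: field_differentiable_def\<close>)
  define F' where "F' = (\<lambda>p. Blinfun (\<lambda>h. (Gx p * fst h + Gy p * snd h, snd h)))"
  have F'_ap: "blinfun_apply (F' p) = (\<lambda>h. (Gx p * fst h + Gy p * snd h, snd h))" for p
    unfolding F'_def
    by (rule bounded_linear_Blinfun_apply)
      (intro bounded_linear_intros bounded_linear_Pair bounded_linear_add bounded_linear_const_mult)
  let ?x0 = "(z0, w0)"
  define inv' where "inv' = Blinfun (\<lambda>h. ((1 / Gx ?x0) * fst h + (- Gy ?x0 / Gx ?x0) * snd h, snd h))"
  have inv'_ap: "blinfun_apply inv' = (\<lambda>h. ((1 / Gx ?x0) * fst h + (- Gy ?x0 / Gx ?x0) * snd h, snd h))"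
    unfolding inv'_def
    by (rule bounded_linear_Blinfun_apply)
      (intro bounded_linear_intros bounded_linear_Pair bounded_linear_add bounded_linear_const_mult)
  have nz': "Gx ?x0 \<noteq> 0" using nz by (simp add: Gx_def)
  obtain U V g g' where *: "open U" "U \<subseteq> W" "?x0 \<in> U" "open V" "F ?x0 \<in> V" "homeomorphism U V F g"
    "\<And>y. y \<in> V \<Longrightarrow> (g has_derivative (g' y)) (at y)"
    "\<And>y. y \<in> V \<Longrightarrow> g' y = inv (blinfun_apply (F' (g y)))"
    "\<And>y. y \<in> V \<Longrightarrow> bij (blinfun_apply (F' (g y)))"
  proof (rule inverse_function_theorem[of W F F' ?x0 inv'])
    show "(F has_derivative blinfun_apply (F' x)) (at x)" if "x \<in> W" for x
      unfolding F'_ap F_def by (intro has_derivative_Pair dG that has_derivative_snd has_derivative_ident)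
    show "continuous_on W F'"
      by (rule continuous_on_blinfun_componentwise) (simp add: F'_ap, intro continuous_intros cx cy)
    show "inv' o\<^sub>L F' ?x0 = id_blinfun"
      using nz' by (intro blinfun_eqI) (simp add: inv'_ap F'_ap field_simps)
  qed (use W p in blast)+
  have gF: "g (F p) = p" "F p \<in> V" if "p \<in> U" for p
    using *(6) that by (auto simp: homeomorphism_def)
  have Fg: "F (g q) = q" "g q \<in> U" if "q \<in> V" for q
    using *(6) that by (auto simp: homeomorphism_def)
  have sg: "snd (g q) = snd q" if "q \<in> V" for q
    using Fg(1)[OF that] by (simp add: F_def prod_eq_iff)
  have pg: "(fst (g (v, w)), w) = g (v, w)" if "(v, w) \<in> V" for v w
    using sg[OF that] by (simp add: prod_eq_iff)
  have hol: "holo2 (\<lambda>q. fst (g q)) V"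
    unfolding holo2_def
  proof
    fix q assume q: "q \<in> V"
    let ?L = "\<lambda>h. (Gx (g q) * fst h + Gy (g q) * snd h, snd h)"
    have bij: "bij ?L" using *(9)[OF q] by (simp add: F'_ap)
    \<comment> \<open>Away from the base point, bijectivity of the derivative comes from the inverse
      function theorem; injectivity in the direction (1, 0) gives back a nonzero partial derivative,
      so the inverse can be written as a complex linear formula.\<close>
    have nzq: "Gx (g q) \<noteq> 0"
    proof
      assume "Gx (g q) = 0"
      then have "?L (1, 0) = ?L (0, 0)" by simp
      with bij have "(1::complex, 0::complex) = (0, 0)" unfolding bij_def by (blast dest: injD)
      then show False by simp
    qed
    have "inv ?L = (\<lambda>h. (1 / Gx (g q) * fst h + (- Gy (g q) / Gx (g q)) * snd h, snd h))"
      using nzq by (intro inv_equality) (auto simp: field_simps prod_eq_iff)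
    then have "(g has_derivative (\<lambda>h. (1 / Gx (g q) * fst h + (- Gy (g q) / Gx (g q)) * snd h, snd h))) (at q)"
      using *(7,8)[OF q] by (simp add: F'_ap)
    from has_derivative_fst[OF this]
    show "\<exists>A B. ((\<lambda>q. fst (g q)) has_derivative (\<lambda>h. A * fst h + B * snd h)) (at q)"
      unfolding fst_conv by blast
  qed
  show ?thesis
  proof (rule that[of U V "\<lambda>q. fst (g q)"])
    show "(G (z0, w0), w0) \<in> V" using *(5) by (simp add: F_def)
    show "(G (z, w), w) \<in> V \<and> fst (g (G (z, w), w)) = z" if "(z, w) \<in> U" for z w
      using gF[OF that] by (simp add: F_def)
    show "(fst (g (v, w)), w) \<in> U \<and> G (fst (g (v, w)), w) = v" if "(v, w) \<in> V" for v w
      using Fg[OF that] pg[OF that] by (simp only:) (simp add: F_def)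
  qed (use * hol in auto)
qed

lemma holo2_compose:
  assumes F: "holo2 F V" and G: "holo2 G W" and H: "holo2 H W"
    and sub: "\<And>p. p \<in> W \<Longrightarrow> (G p, H p) \<in> V"
  shows "holo2 (\<lambda>p. F (G p, H p)) W"
  unfolding holo2_def
proof
  fix p assume p: "p \<in> W"
  obtain A B where 1: "(F has_derivative (\<lambda>h. A * fst h + B * snd h)) (at (G p, H p))"
    using F sub[OF p] by (auto simp: holo2_def)
  obtain A1 B1 where 2: "(G has_derivative (\<lambda>h. A1 * fst h + B1 * snd h)) (at p)"
    using G p by (auto simp: holo2_def)
  obtain A2 B2 where 3: "(H has_derivative (\<lambda>h. A2 * fst h + B2 * snd h)) (at p)"
    using H p by (auto simp: holo2_def)
  have "((\<lambda>p. F (G p, H p)) has_derivative (\<lambda>h. (A * A1 + B * A2) * fst h + (A * B1 + B * B2) * snd h)) (at p)"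
    using has_derivative_compose[OF has_derivative_Pair[OF 2 3] 1]
    by (simp add: algebra_simps)
  then show "\<exists>A B. ((\<lambda>p. F (G p, H p)) has_derivative (\<lambda>h. A * fst h + B * snd h)) (at p)"
    by blast
qed

lemma holo2_fst: "holo2 fst W"
  unfolding holo2_def by (intro ballI exI[of _ 1] exI[of _ 0]) (auto intro!: derivative_eq_intros)

lemma holo2_compose1:
  assumes F: "f holomorphic_on S" "open S" and G: "holo2 G W" and sub: "\<And>p. p \<in> W \<Longrightarrow> G p \<in> S"
  shows "holo2 (\<lambda>p. f (G p)) W"
  unfolding holo2_def
proof
  fix p assume p: "p \<in> W"
  have 1: "(f has_derivative (\<lambda>h. deriv f (G p) * h)) (at (G p))"
    using holomorphic_derivI[OF F sub[OF p]] by (simp add: has_field_derivative_def)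
  obtain A1 B1 where 2: "(G has_derivative (\<lambda>h. A1 * fst h + B1 * snd h)) (at p)"
    using G p by (auto simp: holo2_def)
  show "\<exists>A B. ((\<lambda>p. f (G p)) has_derivative (\<lambda>h. A * fst h + B * snd h)) (at p)"
    by (rule exI[of _ "deriv f (G p) * A1"], rule exI[of _ "deriv f (G p) * B1"])
      (use has_derivative_compose[OF 2 1] in \<open>simp add: algebra_simps\<close>)
qed

section \<open>Passage between real analytic and holomorphic functions\<close>

lemma real_analytic2_complex_extension:
  assumes "real_analytic2_on h S" "(x0, y0) \<in> S"
  obtains H W where "open W" "(of_real x0, of_real y0) \<in> W" "holo2 H W"
    "\<And>x y. (of_real x, of_real y) \<in> W \<Longrightarrow> H (of_real x, of_real y) = of_real (h (x, y))"
proof -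
  obtain c r where r: "r > 0" and hs: "\<And>x y. \<bar>x - x0\<bar> < r \<Longrightarrow> \<bar>y - y0\<bar> < r \<Longrightarrow>
        ((\<lambda>(m, n). c m n * (x - x0) ^ m * (y - y0) ^ n) has_sum h (x, y)) UNIV"
    using assms unfolding real_analytic2_on_def by fastforce
  \<comment> \<open>Smaller than \<open>r\<close>, so that the real series may be evaluated at the
    corner (x0 + d, y0 + d).\<close>
  define d where "d = r / 2"
  have d: "0 < d" "d < r" using r by (auto simp: d_def)
  define T where "T = (\<lambda>(m, n) (z, w). of_real (c m n) * (z - of_real x0) ^ m * (w - of_real y0) ^ n :: complex)"
  define M where "M = (\<lambda>(m, n). norm (c m n * d ^ m * d ^ n))"
  \<comment> \<open>Unconditional summability of a real family is absolute. Hence the terms at the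
    corner dominate the complexified series on the whole closed polydisc of radius \<open>d\<close>,
    and the M-test applies.\<close>
  have M: "M summable_on UNIV"
  proof -
    have "(\<lambda>(m, n). c m n * d ^ m * d ^ n) summable_on UNIV"
      using hs[of "x0 + d" "y0 + d"] d by (auto simp: summable_on_def)
    from summable_on_iff_abs_summable_on_real[THEN iffD1, OF this] show ?thesis
      by (simp add: M_def case_prod_unfold)
  qed
  define H where "H = (\<lambda>p. \<Sum>\<^sub>\<infinity>q\<in>UNIV. T q p)"
  let ?C = "cball (of_real x0) d \<times> cball (of_real y0) d :: (complex \<times> complex) set"
  let ?W = "ball (of_real x0) d \<times> ball (of_real y0) d :: (complex \<times> complex) set"
  have ul: "uniform_limit ?C (\<lambda>X p. \<Sum>q\<in>X. T q p) H (finite_subsets_at_top UNIV)"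
    unfolding H_def
  proof (rule Weierstrass_m_test_general[OF _ M])
    fix q :: "nat \<times> nat" and p assume p: "p \<in> ?C"
    show "norm (T q p) \<le> M q"
      using p d by (cases q; cases p)
        (auto simp: T_def M_def norm_mult norm_power abs_mult power_abs dist_norm norm_minus_commute
          intro!: mult_mono power_mono)
  qed
  have Tc: "continuous_on X (T q)" for X q
    by (cases q) (auto simp: T_def case_prod_beta intro!: continuous_intros)
  have cH: "continuous_on ?C H"
    by (rule uniform_limit_theorem[OF always_eventually ul])
      (auto intro!: continuous_on_sum Tc)
  have h1: "(\<lambda>z. H (z, w)) holomorphic_on ball (of_real x0) d" if "w \<in> cball (of_real y0) d" for w
  proof -
    have "uniform_limit (cball (of_real x0) d) (\<lambda>X z. \<Sum>q\<in>X. T q (z, w)) (\<lambda>z. H (z, w)) (finite_subsets_at_top UNIV)"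
      using ul that unfolding uniform_limit_iff by (auto elim!: eventually_mono)
    then show ?thesis
      by (rule holomorphic_uniform_limit[rotated])
        (auto simp: T_def case_prod_beta intro!: always_eventually continuous_intros holomorphic_intros)
  qed
  have h2: "(\<lambda>w. H (z, w)) holomorphic_on ball (of_real y0) d" if "z \<in> cball (of_real x0) d" for z
  proof -
    have "uniform_limit (cball (of_real y0) d) (\<lambda>X w. \<Sum>q\<in>X. T q (z, w)) (\<lambda>w. H (z, w)) (finite_subsets_at_top UNIV)"
      using ul that unfolding uniform_limit_iff by (auto elim!: eventually_mono)
    then show ?thesis
      by (rule holomorphic_uniform_limit[rotated])
        (auto simp: T_def case_prod_beta intro!: always_eventually continuous_intros holomorphic_intros)
  qed
  show ?thesis
  proof (rule that[of ?W H])
    show "holo2 H ?W"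
    proof (rule holo2I_separately)
      show "continuous_on ?W H" by (rule continuous_on_subset[OF cH]) auto
      fix z w assume "(z, w) \<in> ?W"
      then have zw: "z \<in> ball (of_real x0) d" "w \<in> ball (of_real y0) d" by auto
      show "(\<lambda>x. H (x, w)) field_differentiable at z"
        using h1[of w] zw holomorphic_on_imp_differentiable_at[of _ "ball (of_real x0) d" z] by auto
      show "(\<lambda>x. H (z, x)) field_differentiable at w"
        using h2[of z] zw holomorphic_on_imp_differentiable_at[of _ "ball (of_real y0) d" w] by auto
    qed (auto intro: open_Times)
    show "H (of_real x, of_real y) = of_real (h (x, y))" if "(of_real x, of_real y) \<in> ?W" for x y
    proof -
      have "\<bar>x - x0\<bar> < r" "\<bar>y - y0\<bar> < r"
        using that d by (auto simp: dist_norm simp flip: of_real_diff)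
      from has_sum_of_real[OF hs[OF this], where 'a = complex]
      have "((\<lambda>q. T q (of_real x, of_real y)) has_sum of_real (h (x, y))) UNIV"
        by (simp add: T_def case_prod_beta)
      then show ?thesis by (simp add: H_def infsumI)
    qed
  qed (use d in \<open>auto intro: open_Times\<close>)
qed

text \<open>Powers of the real number t - t0 pass through \<open>Re\<close>, so taking real parts of
  the Taylor coefficients turns the complex expansion into a real one.\<close>

lemma real_analytic_on_Re_holomorphic:
  assumes F: "F holomorphic_on S" and S: "open S"
    and I: "\<And>t. t \<in> I \<Longrightarrow> of_real t \<in> S"
  shows "real_analytic_on (\<lambda>t. Re (F (of_real t))) I"
  unfolding real_analytic_on_def
proof
  fix t0 assume "t0 \<in> I"
  then obtain r where r: "r > 0" "ball (of_real t0) r \<subseteq> S"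
    using S I open_contains_ball by blast
  show "\<exists>c. \<exists>r>0. \<forall>t. \<bar>t - t0\<bar> < r \<longrightarrow> (\<lambda>n. c n * (t - t0) ^ n) sums Re (F (of_real t))"
  proof (rule exI[of _ "\<lambda>n. Re ((deriv ^^ n) F (of_real t0) / fact n)"], rule exI[of _ r], intro conjI allI impI r(1))
    fix t assume t: "\<bar>t - t0\<bar> < r"
    have "of_real t \<in> ball (of_real t0 :: complex) r"
      using t by (simp add: dist_norm norm_minus_commute flip: of_real_diff)
    from holomorphic_power_series[OF holomorphic_on_subset[OF F r(2)] this]
    have "(\<lambda>n. Re ((deriv ^^ n) F (of_real t0) / fact n * (of_real t - of_real t0) ^ n)) sums Re (F (of_real t))"
      by (rule sums_Re)
    moreover have "Re ((deriv ^^ n) F (of_real t0) / fact n * (of_real t - of_real t0) ^ n)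
      = Re ((deriv ^^ n) F (of_real t0) / fact n) * (t - t0) ^ n" for n
      unfolding of_real_diff[symmetric] of_real_power[symmetric] by (subst times_complex.sel) simp
    ultimately show "(\<lambda>n. Re ((deriv ^^ n) F (of_real t0) / fact n) * (t - t0) ^ n) sums Re (F (of_real t))"
      by simp
  qed
qed

section \<open>Geodesics starting at a turning point\<close>

definition dvarphi :: "real \<Rightarrow> real \<Rightarrow> real" where
  "dvarphi a r = a * cos (2 * phi_of a r) /
     (cos (phi_of a r) * sqrt (a\<^sup>2 * (cos (phi_of a r))\<^sup>2 + (sin (phi_of a r))\<^sup>2))"

lemma varphi_has_derivative:
  assumes "a > 0" "0 < r" "r < L_len a"
  shows "(varphi a has_real_derivative dvarphi a r) (at r)"
  unfolding varphi_def[abs_def] dvarphi_def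
  by (rule derivative_eq_intros refl phi_of_has_derivative[OF assms])+ (simp add: field_simps)

lemma varphi_pos:
  assumes "a > 0" "0 < r" "r < L_len a"
  shows "varphi a r > 0"
proof -
  obtain x where "0 < x" "x < pi / 2" "phi_of a r = x"
    using polar_angle_exists[OF assms] .
  then show ?thesis using assms(1) by (simp add: varphi_def sin_gt_zero)
qed

lemma open_polar_domain: "open (polar_domain a)"
  unfolding polar_domain_def
  by (intro open_Collect_conj open_Collect_less continuous_intros)

lemma partial_deriv_eqI:
  assumes "(h has_derivative h') (at p)"
  shows "partial_deriv i h p = h' (axis i 1)"
  using frechet_derivative_at[OF assms] by (simp add: partial_deriv_def)

text \<open>Only the angular entry varies, and only with the radius. \<open>Omega_metric\<close> is
  known explicitly just on \<open>polar_domain a\<close>, so each derivative is computed for the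
  explicit entry and transferred along this open set.\<close>

lemma partial_deriv_Omega_metric:
  assumes a: "a > 0" and p: "p \<in> polar_domain a"
  shows "partial_deriv i (\<lambda>q. Omega_metric a q $ j $ l) p =
    (if i = 1 \<and> j = 2 \<and> l = 2 then 2 * varphi a (p $ 1) * dvarphi a (p $ 1) else 0)"
proof -
  have r: "0 < p $ 1" "p $ 1 < L_len a" using p by (auto simp: polar_domain_def)
  have const: "partial_deriv i (\<lambda>q. Omega_metric a q $ j $ l) p = 0"
    if "\<And>q. q \<in> polar_domain a \<Longrightarrow> Omega_metric a q $ j $ l = C" for C j l
  proof -
    have "((\<lambda>q. Omega_metric a q $ j $ l) has_derivative (\<lambda>h. 0)) (at p)"
      by (rule has_derivative_transform_within_open[OF has_derivative_const[of C] open_polar_domain p])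
        (simp add: that)
    then show ?thesis by (rule partial_deriv_eqI)
  qed
  have d: "partial_deriv i (\<lambda>q. Omega_metric a q $ 2 $ 2) p
      = 2 * varphi a (p $ 1) * dvarphi a (p $ 1) * axis i 1 $ 1"
  proof (rule partial_deriv_eqI)
    have "(varphi a has_derivative (\<lambda>h. dvarphi a (p $ 1) * h)) (at (p $ 1))"
      using varphi_has_derivative[OF a r] by (simp add: has_field_derivative_def)
    from has_derivative_compose[OF bounded_linear_imp_has_derivative[OF bounded_linear_vec_nth] this]
    have "((\<lambda>q. varphi a (q $ 1)) has_derivative (\<lambda>h. dvarphi a (p $ 1) * h $ 1)) (at p)" .
    from has_derivative_power[OF this, of 2]
    have "((\<lambda>q. (varphi a (q $ 1))\<^sup>2) has_derivative (\<lambda>h. 2 * varphi a (p $ 1) * dvarphi a (p $ 1) * h $ 1)) (at p)"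
      by (simp add: mult_ac)
    then show "((\<lambda>q. Omega_metric a q $ 2 $ 2) has_derivative (\<lambda>h. 2 * varphi a (p $ 1) * dvarphi a (p $ 1) * h $ 1)) (at p)"
      by (rule has_derivative_transform_within_open[OF _ open_polar_domain p])
        (simp add: Omega_metric_polar[OF a])
  qed
  note m = Omega_metric_polar[OF a]
  show ?thesis
    using exhaust_2[of i] exhaust_2[of j] exhaust_2[of l] d
      const[where C=0, OF m(2)] const[where C=0, OF m(3)] const[where C=1, OF m(1)]
    by (auto simp: axis_def m)
qed

lemma matrix_inv_Omega_metric:
  assumes a: "a > 0" and p: "p \<in> polar_domain a"
  shows "matrix_inv (Omega_metric a p) =
    (\<chi> i j. if i \<noteq> j then 0 else if i = 1 then 1 else 1 / (varphi a (p $ 1))\<^sup>2)" (is "_ = ?B")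
proof -
  let ?A = "Omega_metric a p"
  have "varphi a (p $ 1) \<noteq> 0" using varphi_pos[OF a] p by (force simp: polar_domain_def)
  then have AB: "?A ** ?B = mat 1" "?B ** ?A = mat 1"
    by (auto simp: matrix_matrix_mult_def mat_def vec_eq_iff sum_2 forall_2 Omega_metric_polar[OF a p])
  then have "?A ** matrix_inv ?A = mat 1"
    unfolding matrix_inv_def by (rule_tac someI2[of _ ?B]) auto
  then have "?B ** (?A ** matrix_inv ?A) = ?B" by simp
  then show ?thesis using AB by (simp add: matrix_mul_assoc)
qed

text \<open>The metric is that of a surface of revolution: the only nonzero Christoffel symbols are
  -varphi varphi' (upper index 1, lower indices 2, 2) and varphi' / varphi (upper index 2, mixed
  lower indices).\<close>

lemma geodesic_equations:
  assumes a: "a > 0" and geo: "geodesic_on (Omega_metric a) (polar_domain a) UNIV c"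
  obtains v where "\<And>t. (c has_vector_derivative v t) (at t)"
    "\<And>t. ((\<lambda>t. v t $ 1) has_real_derivative
        varphi a (c t $ 1) * dvarphi a (c t $ 1) * (v t $ 2)\<^sup>2) (at t)"
    "\<And>t. ((\<lambda>t. v t $ 2) has_real_derivative
        - (2 * dvarphi a (c t $ 1) / varphi a (c t $ 1) * v t $ 1 * v t $ 2)) (at t)"
proof -
  obtain v where v: "\<And>t. (c has_vector_derivative v t) (at t)"
    and v': "\<And>t. (v has_vector_derivative (\<chi> m. - (\<Sum>i\<in>UNIV. \<Sum>j\<in>UNIV.
            christoffel (Omega_metric a) (c t) m i j * v t $ i * v t $ j))) (at t)"
    and dom: "\<And>t. c t \<in> polar_domain a"
    using geo unfolding geodesic_on_def by blast
  have comp: "((\<lambda>t. v t $ i) has_real_derivative (\<chi> m. - (\<Sum>i\<in>UNIV. \<Sum>j\<in>UNIV.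
            christoffel (Omega_metric a) (c t) m i j * v t $ i * v t $ j)) $ i) (at t)" for t i
    unfolding has_real_derivative_iff_has_vector_derivative
    by (rule bounded_linear.has_vector_derivative[OF bounded_linear_vec_nth v'])
  have nz: "varphi a (c t $ 1) \<noteq> 0" for t
    using varphi_pos[OF a] dom[of t] by (force simp: polar_domain_def)
  show ?thesis
  proof (rule that[OF v])
    fix t
    show "((\<lambda>t. v t $ 1) has_real_derivative
        varphi a (c t $ 1) * dvarphi a (c t $ 1) * (v t $ 2)\<^sup>2) (at t)"
      using comp[of 1 t]
      by (simp add: sum_2 christoffel_def partial_deriv_Omega_metric[OF a dom]
          matrix_inv_Omega_metric[OF a dom] power2_eq_square mult_ac)
    show "((\<lambda>t. v t $ 2) has_real_derivative
        - (2 * dvarphi a (c t $ 1) / varphi a (c t $ 1) * v t $ 1 * v t $ 2)) (at t)"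
      using comp[of 2 t] nz[of t]
      by (simp add: sum_2 christoffel_def partial_deriv_Omega_metric[OF a dom]
          matrix_inv_Omega_metric[OF a dom] power2_eq_square field_simps)
  qed
qed

text \<open>This is d\<theta> / d\<psi>, the quotient of \<open>theta'\<close> and the phase
  velocity \<open>omega\<close> below, with everything expressed by u = m cos \<psi> = cos (2 x). It
  stays regular at turning points and at \<open>m = 0\<close>, where \<rho> is useless as a
  parameter.\<close>

definition angle_density :: "real \<Rightarrow> real \<Rightarrow> real \<Rightarrow> real" where
  "angle_density a m p = sqrt (1 - m\<^sup>2) / (2 * a) *
     (sqrt ((1 + m * cos p) * (a\<^sup>2 * (1 + m * cos p) + (1 - m * cos p))) / (1 - (m * cos p)\<^sup>2))"

definition half_period_angle :: "real \<Rightarrow> real \<Rightarrow> real" where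
  "half_period_angle a m = integral {0..pi} (angle_density a m)"

lemma abs_mult_cos_less_1:
  fixes m p :: real
  assumes "\<bar>m\<bar> < 1"
  shows "\<bar>m * cos p\<bar> < 1"
  using assms mult_left_mono[OF abs_cos_le_one[of p], of "\<bar>m\<bar>"] by (simp add: abs_mult)

lemma angle_density_pos:
  assumes "a > 0" "\<bar>m\<bar> < 1"
  shows "angle_density a m p > 0"
proof -
  have "\<bar>m * cos p\<bar> < 1" by (rule abs_mult_cos_less_1[OF assms(2)])
  moreover have "(m * cos p)\<^sup>2 < 1" "m\<^sup>2 < 1"
    using calculation assms(2) by (simp_all add: abs_square_less_1)
  moreover have "0 < 1 + m * cos p" "0 < 1 - m * cos p" using calculation(1) by linarith+
  moreover have "0 < a\<^sup>2 * (1 + m * cos p) + (1 - m * cos p)"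
    using calculation assms(1) by (meson add_pos_pos mult_pos_pos zero_less_power)
  moreover have "0 < (1 + m * cos p) * (a\<^sup>2 * (1 + m * cos p) + (1 - m * cos p))"
    using calculation by (meson mult_pos_pos)
  ultimately show ?thesis
    using assms unfolding angle_density_def
    by (intro mult_pos_pos[of "_ / _"] divide_pos_pos real_sqrt_gt_zero) simp_all
qed

lemma continuous_angle_density:
  assumes "a > 0" "\<bar>m\<bar> < 1"
  shows "isCont (angle_density a m) p"
proof -
  have "(m * cos p)\<^sup>2 < 1"
    using abs_mult_cos_less_1[OF assms(2)] by (simp add: abs_square_less_1)
  then show ?thesis
    unfolding angle_density_def[abs_def] using assms by (intro continuous_intros) auto
qed

lemma real_antiderivative:
  fixes f :: "real \<Rightarrow> real"
  assumes "\<And>x. isCont f x"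
  obtains F where "F 0 = 0" "\<And>x. (F has_real_derivative f x) (at x)"
proof -
  obtain F where "\<forall>x. (F has_vector_derivative f x) (at x)"
    using einterval_antiderivative[of "-\<infinity>" \<infinity> f] assms by auto
  then have "((\<lambda>x. F x - F 0) has_real_derivative f x) (at x)" for x
    by (auto simp: has_real_derivative_iff_has_vector_derivative intro!: derivative_eq_intros)
  then show ?thesis using that[of "\<lambda>x. F x - F 0"] by simp
qed

text \<open>The density depends on the phase only through its cosine, so it is symmetric about pi
  and has period 2 pi; consecutive intervals of length pi therefore contribute equally.\<close>

lemma angle_primitive:
  assumes "a > 0" "\<bar>m\<bar> < 1"
  obtains F where "F 0 = 0" "\<And>x. (F has_real_derivative angle_density a m x) (at x)"
    "strict_mono F" "\<And>j. F (real j * pi) = real j * half_period_angle a m"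
proof -
  obtain F where F: "F 0 = 0" "\<And>x. (F has_real_derivative angle_density a m x) (at x)"
    using real_antiderivative continuous_angle_density[OF assms] by metis
  have "(angle_density a m has_integral (F pi - F 0)) {0..pi}"
    by (rule fundamental_theorem_of_calculus)
      (auto simp: has_real_derivative_iff_has_vector_derivative[symmetric] intro: has_field_derivative_at_within F)
  then have Fpi: "F pi = half_period_angle a m"
    by (simp add: half_period_angle_def F integral_unique)
  \<comment> \<open>Symmetry about pi: the sum is constant, and comparing its values at pi and 0
    gives F (2 pi) = 2 F pi.\<close>
  have "((\<lambda>x. F (2 * pi - x) + F x) has_real_derivative 0) (at x)" for x
    by (rule derivative_eq_intros DERIV_chain2[OF F(2)] F(2) refl)+
      (simp add: angle_density_def cos_diff)
  from DERIV_isconst_all[OF allI[OF this], of pi 0] have F2: "F (2 * pi) = 2 * F pi"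
    by (simp add: F)
  have "((\<lambda>x. F (x + 2 * pi) - F x) has_real_derivative 0) (at x)" for x
    by (rule derivative_eq_intros DERIV_chain2[OF F(2)] F(2) refl)+
      (simp add: angle_density_def)
  from DERIV_isconst_all[OF allI[OF this], of _ 0] have per: "F (x + 2 * pi) = F x + 2 * F pi" for x
    using F2 by (simp add: F) (metis add.commute diff_add_cancel)
  \<comment> \<open>A period consists of two intervals of length pi, so the induction advances by
    two.\<close>
  have "F (real j * pi) = real j * F pi" for j
  proof (induction j rule: induct_nat_012)
    case (ge2 n)
    then show ?case using per[of "real n * pi"] by (simp add: algebra_simps)
  qed (auto simp: F)
  moreover have "strict_mono F"
    by (rule strict_monoI, rule DERIV_pos_imp_increasing) (use F angle_density_pos[OF assms] in blast)+
  ultimately show ?thesis using that F Fpi by metis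
qed

lemma half_period_angle_pos:
  assumes "a > 0" "\<bar>m\<bar> < 1"
  shows "half_period_angle a m > 0"
proof -
  obtain F where F: "F 0 = 0" "\<And>x. (F has_real_derivative angle_density a m x) (at x)"
    "strict_mono F" "\<And>j. F (real j * pi) = real j * half_period_angle a m"
    using angle_primitive[OF assms] by blast
  have "F 0 < F pi" by (rule strict_monoD[OF F(3)]) simp
  with F(1) F(4)[of 1] show ?thesis by simp
qed

section \<open>Conservation laws and the phase of a geodesic\<close>

locale turning_geodesic =
  fixes a :: real and c :: "real \<Rightarrow> real ^ 2"
  assumes a: "a > 0"
    and geo: "geodesic_on (Omega_metric a) (polar_domain a) UNIV c"
    and c0: "c 0 $ 2 = 0"
    and vel: "(c has_vector_derivative vector [0, 1]) (at 0)"
begin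

definition x where "x t = phi_of a (c t $ 1)"
text \<open>Up to the factor 2 pi, the derivative of \<open>rho_of a\<close> at the current
  angle.\<close>

definition K where "K t = cos (x t) * sqrt (a\<^sup>2 * (cos (x t))\<^sup>2 + (sin (x t))\<^sup>2)"
definition m where "m = cos (2 * x 0)"
definition S where "S = sin (2 * x 0)"
definition rho' where "rho' t = vector_derivative c (at t) $ 1"
definition theta' where "theta' t = vector_derivative c (at t) $ 2"

lemma domain: "0 < c t $ 1" "c t $ 1 < L_len a"
  using geo by (auto simp: geodesic_on_def polar_domain_def)

lemma x_range: "0 < x t" "x t < pi / 2"
  using polar_angle_exists[OF a domain[of t]] unfolding x_def by metis+

lemma K_pos: "K t > 0"
  using x_range[of t] speed_pos[OF a, of "x t"] by (simp add: K_def cos_gt_zero)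

text \<open>By the double angle formulas. Once cos (2 x) = m cos \<psi> is known, the right-hand
  side is the radicand in \<open>angle_density\<close>.\<close>

lemma K_squared: "4 * (K t)\<^sup>2 = (1 + cos (2 * x t)) * (a\<^sup>2 * (1 + cos (2 * x t)) + (1 - cos (2 * x t)))"
proof -
  have 1: "1 + cos (2 * x t) = 2 * (cos (x t))\<^sup>2" by (simp add: cos_double_cos)
  have 2: "1 - cos (2 * x t) = 2 * (sin (x t))\<^sup>2" by (simp add: cos_double_sin)
  show ?thesis using speed_pos[OF a, of "x t"]
    unfolding 1 2 by (simp add: K_def power_mult_distrib algebra_simps)
qed

lemma sin_pos: "sin (2 * x t) > 0"
  using x_range[of t] by (simp add: sin_gt_zero)

lemma S_pos: "S > 0" and m_bound: "\<bar>m\<bar> < 1" and S_eq: "S = sqrt (1 - m\<^sup>2)"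
proof -
  show S: "S > 0" using sin_pos by (simp add: S_def)
  have "m\<^sup>2 + S\<^sup>2 = 1" by (simp add: S_def m_def)
  then have S2: "S\<^sup>2 = 1 - m\<^sup>2" by simp
  then have "m\<^sup>2 < 1" using S by (metis diff_gt_0_iff_gt zero_less_power)
  then show "\<bar>m\<bar> < 1" by (simp add: abs_square_less_1)
  show "S = sqrt (1 - m\<^sup>2)" using S S2 by (metis less_imp_le real_sqrt_unique)
qed

lemma init: "rho' 0 = 0" "theta' 0 = 1"
  using vector_derivative_at[OF vel] by (simp_all add: rho'_def theta'_def)

lemma derivs:
  "((\<lambda>t. c t $ 1) has_real_derivative rho' t) (at t)" (is ?A)
  "((\<lambda>t. c t $ 2) has_real_derivative theta' t) (at t)" (is ?B)
  "(rho' has_real_derivative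
      pi * a\<^sup>2 * sin (2 * x t) * cos (2 * x t) / K t * (theta' t)\<^sup>2) (at t)" (is ?C)
  "(theta' has_real_derivative
      - (2 * cos (2 * x t) / (pi * K t * sin (2 * x t)) * rho' t * theta' t)) (at t)" (is ?D)
proof -
  obtain v where v: "\<And>t. (c has_vector_derivative v t) (at t)"
    "\<And>t. ((\<lambda>t. v t $ 1) has_real_derivative
        varphi a (c t $ 1) * dvarphi a (c t $ 1) * (v t $ 2)\<^sup>2) (at t)"
    "\<And>t. ((\<lambda>t. v t $ 2) has_real_derivative
        - (2 * dvarphi a (c t $ 1) / varphi a (c t $ 1) * v t $ 1 * v t $ 2)) (at t)"
    using geodesic_equations[OF a geo] by blast
  have v_eq: "v = (\<lambda>t. vector_derivative c (at t))"
    using vector_derivative_at[OF v(1)] by auto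
  have e: "rho' = (\<lambda>t. v t $ 1)" "theta' = (\<lambda>t. v t $ 2)"
    by (auto simp: rho'_def theta'_def v_eq)
  show ?A ?B unfolding e has_real_derivative_iff_has_vector_derivative
    by (rule bounded_linear.has_vector_derivative[OF bounded_linear_vec_nth v(1)])+
  have d: "dvarphi a (c t $ 1) = a * cos (2 * x t) / K t"
    by (simp add: dvarphi_def K_def x_def)
  have p: "varphi a (c t $ 1) = pi * a * sin (2 * x t)"
    by (simp add: varphi_def x_def)
  show ?C using v(2)[of t] unfolding d p e by (simp add: power2_eq_square mult_ac)
  show ?D using v(3)[of t] a unfolding d p e by (simp add: mult_ac)
qed

lemma x_deriv: "(x has_real_derivative rho' t / (2 * pi * K t)) (at t)"
  using DERIV_chain2[OF phi_of_has_derivative[OF a domain] derivs(1), of t]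
  unfolding x_def[abs_def] K_def by simp

text \<open>Rotational invariance conserves the angular momentum varphi^2 \<theta>'; the constant
  factor (pi a)^2 is divided out. The initial angular velocity 1 gives the value.\<close>

lemma clairaut: "theta' t * (sin (2 * x t))\<^sup>2 = S\<^sup>2"
proof -
  have "((\<lambda>t. theta' t * (sin (2 * x t))\<^sup>2) has_real_derivative 0) (at t)" for t
    by (rule derivative_eq_intros derivs x_deriv refl)+
      (use K_pos[of t] sin_pos[of t] in \<open>simp add: field_simps power2_eq_square\<close>)
  from DERIV_isconst_all[OF allI[OF this], of t 0] show ?thesis
    by (simp add: init S_def)
qed

text \<open>Geodesics have constant speed, and the initial velocity is purely angular.\<close>

lemma energy: "(rho' t)\<^sup>2 + (pi * a)\<^sup>2 * (sin (2 * x t))\<^sup>2 * (theta' t)\<^sup>2 = (pi * a)\<^sup>2 * S\<^sup>2"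
proof -
  have "((\<lambda>t. (rho' t)\<^sup>2 + (pi * a)\<^sup>2 * (sin (2 * x t))\<^sup>2 * (theta' t)\<^sup>2) has_real_derivative 0) (at t)" for t
    by (rule derivative_eq_intros derivs x_deriv refl)+
      (use K_pos[of t] sin_pos[of t] in \<open>simp add: field_simps power2_eq_square\<close>)
  from DERIV_isconst_all[OF allI[OF this], of t 0] show ?thesis
    by (simp add: init S_def)
qed

lemma theta'_eq: "theta' t = S\<^sup>2 / (sin (2 * x t))\<^sup>2"
  using clairaut[of t] sin_pos[of t] by (simp add: field_simps)

lemma rho'_squared: "(rho' t)\<^sup>2 = (pi * a)\<^sup>2 * S\<^sup>2 * (1 - S\<^sup>2 / (sin (2 * x t))\<^sup>2)"
  using energy[of t] sin_pos[of t] unfolding theta'_eq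
  by (simp add: field_simps power2_eq_square)

text \<open>The start lies on the longest circle, where the angular momentum is already maximal for
  the given energy and nothing is left for radial motion. The conservation laws thus identify the
  trivial solution without a uniqueness theorem for the differential equation.\<close>

lemma rho'_zero:
  assumes "m = 0"
  shows "rho' t = 0"
proof -
  have "S = 1" using S_eq assms by simp
  have "(sin (2 * x t))\<^sup>2 \<le> 1" by (simp add: abs_square_le_1)
  then have "1 \<le> 1 / (sin (2 * x t))\<^sup>2" using sin_pos[of t] by (simp add: field_simps)
  then have "(rho' t)\<^sup>2 \<le> 0"
    unfolding rho'_squared \<open>S = 1\<close> by (simp add: mult_nonneg_nonpos)
  then show ?thesis by simp
qed

lemma theta'_ge: "theta' t \<ge> S\<^sup>2"
proof -
  have "(sin (2 * x t))\<^sup>2 \<le> 1" by (simp add: abs_square_le_1)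
  then show ?thesis using sin_pos[of t] S_pos by (simp add: theta'_eq field_simps)
qed

lemma theta_crossing:
  assumes "b > 0"
  shows "\<exists>!t. t > 0 \<and> c t $ 2 = b"
proof -
  have mono: "c s $ 2 < c t $ 2" if "s < t" for s t
    using that by (rule DERIV_pos_imp_increasing)
      (use derivs(2) theta'_ge S_pos in \<open>meson zero_less_power less_le_trans\<close>)
  have ge: "S\<^sup>2 * t \<le> c t $ 2" if "t > 0" for t
  proof -
    have "c 0 $ 2 - S\<^sup>2 * 0 \<le> c t $ 2 - S\<^sup>2 * t"
    proof (rule DERIV_nonneg_imp_nondecreasing[of 0 t "\<lambda>t. c t $ 2 - S\<^sup>2 * t"])
      fix u :: real
      have "((\<lambda>t. c t $ 2 - S\<^sup>2 * t) has_real_derivative theta' u - S\<^sup>2) (at u)"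
        by (rule derivative_eq_intros derivs refl | simp)+
      then show "\<exists>y. ((\<lambda>t. c t $ 2 - S\<^sup>2 * t) has_real_derivative y) (at u) \<and> 0 \<le> y"
        using theta'_ge[of u] by auto
    qed (use that in simp)
    then show ?thesis by (simp add: c0)
  qed
  \<comment> \<open>The angle starts at 0 and grows at least at the rate S^2, so it has reached
    \<open>b\<close> by this time.\<close>
  define T where "T = b / S\<^sup>2"
  have T: "T > 0" "b \<le> c T $ 2"
    using assms S_pos ge[of T] by (auto simp: T_def)
  have "\<exists>t. 0 \<le> t \<and> t \<le> T \<and> c t $ 2 = b"
    by (rule IVT[of "\<lambda>t. c t $ 2"]) (use T assms c0 derivs(2) DERIV_isCont in auto)
  then obtain t where t: "0 \<le> t" "c t $ 2 = b" by blast
  with assms c0 have "t > 0" by (cases "t = 0") auto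
  show ?thesis
  proof (rule ex1I[of _ t])
    show "s = t" if "s > 0 \<and> c s $ 2 = b" for s
      using that t mono[of s t] mono[of t s] by (cases s t rule: linorder_cases) auto
  qed (use t \<open>t > 0\<close> in auto)
qed

definition omega where "omega t = a * S / K t"

text \<open>The phase is obtained by integrating its velocity \<open>omega\<close>. Solving cos (2
  x) = m cos \<psi> with an arccosine would lose smoothness and the sign of \<open>rho'\<close>
  exactly at the turning points.\<close>

lemma phase:
  assumes m: "m \<noteq> 0"
  obtains \<psi> where "\<psi> 0 = 0" "\<And>t. (\<psi> has_real_derivative omega t) (at t)"
    "\<And>t. cos (2 * x t) = m * cos (\<psi> t)" "\<And>t. rho' t * sin (2 * x t) = pi * a * S * m * sin (\<psi> t)"
proof -
  have "isCont K t" for t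
    unfolding K_def by (intro continuous_intros DERIV_isCont[OF x_deriv])
  then have "isCont omega t" for t
    unfolding omega_def[abs_def] using K_pos[of t] by (intro continuous_intros) auto
  then obtain \<psi> where psi: "\<psi> 0 = 0" "\<And>t. (\<psi> has_real_derivative omega t) (at t)"
    using real_antiderivative by metis
  \<comment> \<open>\<open>X\<close> and \<open>Y\<close> are scaled so that X' = - omega Y and Y' =
    omega X: the pair rotates with angular velocity \<open>omega\<close> and starts at (1,
    0).\<close>
  define X where "X t = cos (2 * x t) / m" for t
  define Y where "Y t = rho' t * sin (2 * x t) / (pi * a * S * m)" for t
  have X: "(X has_real_derivative - omega t * Y t) (at t)" for t
    unfolding X_def[abs_def]
    by (rule derivative_eq_intros x_deriv refl m)+
      (use m a S_pos K_pos[of t] in \<open>simp add: Y_def omega_def field_simps\<close>)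
  have Y: "(Y has_real_derivative omega t * X t) (at t)" for t
  proof -
    have "((\<lambda>t. rho' t * sin (2 * x t)) has_real_derivative
        pi * a\<^sup>2 * sin (2 * x t) * cos (2 * x t) / K t * (theta' t)\<^sup>2 * sin (2 * x t)
          + (rho' t)\<^sup>2 * cos (2 * x t) / (pi * K t)) (at t)"
      by (rule derivative_eq_intros derivs x_deriv refl)+
        (use K_pos[of t] in \<open>simp add: field_simps power2_eq_square\<close>)
    \<comment> \<open>The derivative contains precisely the conserved energy, which makes it a
      multiple of cos (2 x) alone.\<close>
    moreover have "pi * a\<^sup>2 * sin (2 * x t) * cos (2 * x t) / K t * (theta' t)\<^sup>2 * sin (2 * x t)
          + (rho' t)\<^sup>2 * cos (2 * x t) / (pi * K t)
        = cos (2 * x t) / (pi * K t) * ((rho' t)\<^sup>2 + (pi * a)\<^sup>2 * (sin (2 * x t))\<^sup>2 * (theta' t)\<^sup>2)"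
      using K_pos[of t] by (simp add: field_simps power2_eq_square)
    ultimately have "((\<lambda>t. rho' t * sin (2 * x t)) has_real_derivative
        cos (2 * x t) / (pi * K t) * ((pi * a)\<^sup>2 * S\<^sup>2)) (at t)"
      unfolding energy by simp
    from DERIV_cdivide[OF this, of "pi * a * S * m"] show ?thesis
      unfolding Y_def[abs_def] X_def omega_def
      using m a S_pos K_pos[of t] by (simp add: field_simps power2_eq_square)
  qed
  have X0: "X 0 = 1" using m by (simp add: X_def m_def)
  have Y0: "Y 0 = 0" by (simp add: Y_def init)
  \<comment> \<open>Rotating (X, Y) back by the phase gives a constant vector, here its first and
    afterwards its second coordinate; with cos^2 + sin^2 = 1 this determines \<open>X\<close> and
    \<open>Y\<close>.\<close>
  have "((\<lambda>t. X t * cos (\<psi> t) + Y t * sin (\<psi> t)) has_real_derivative 0) (at t)" for t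
    by (rule derivative_eq_intros X Y psi refl)+ (simp add: algebra_simps)
  from DERIV_isconst_all[OF allI[OF this], of _ 0]
  have 1: "X t * cos (\<psi> t) + Y t * sin (\<psi> t) = 1" for t by (simp add: X0 Y0 psi)
  have "((\<lambda>t. Y t * cos (\<psi> t) - X t * sin (\<psi> t)) has_real_derivative 0) (at t)" for t
    by (rule derivative_eq_intros X Y psi refl)+ (simp add: algebra_simps)
  from DERIV_isconst_all[OF allI[OF this], of _ 0]
  have 2: "Y t * cos (\<psi> t) - X t * sin (\<psi> t) = 0" for t by (simp add: X0 Y0 psi)
  have cs: "(cos (\<psi> t))\<^sup>2 + (sin (\<psi> t))\<^sup>2 = 1" for t by simp
  have "X t = cos (\<psi> t)" "Y t = sin (\<psi> t)" for t
    using 1[of t] 2[of t] cs[of t] by algebra+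
  then show ?thesis
    using m a S_pos by (intro that[OF psi]) (auto simp: X_def Y_def field_simps)
qed

text \<open>\<open>F\<close> turns phase into angle: F o \<psi> and the lifted angle have the same
  derivative and the same initial value. Turning points are the phases in pi \<int>, which
  \<open>F\<close> sends to multiples of the half period angle; strict monotonicity gives the
  converse.\<close>

lemma rho'_zero_iff:
  assumes m: "m \<noteq> 0" and b: "b > 0" and t: "c t $ 2 = b"
  shows "rho' t = 0 \<longleftrightarrow> (\<exists>j\<ge>1. real j * half_period_angle a m = b)"
proof -
  obtain \<psi> where psi: "\<psi> 0 = 0" "\<And>t. (\<psi> has_real_derivative omega t) (at t)"
    "\<And>t. cos (2 * x t) = m * cos (\<psi> t)" "\<And>t. rho' t * sin (2 * x t) = pi * a * S * m * sin (\<psi> t)"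
    using phase[OF m] by blast
  obtain F where F: "F 0 = 0" "\<And>x. (F has_real_derivative angle_density a m x) (at x)"
    "strict_mono F" "\<And>j. F (real j * pi) = real j * half_period_angle a m"
    using angle_primitive[OF a m_bound] by blast
  have dens: "angle_density a m (\<psi> t) * omega t = theta' t" for t
  proof -
    have "sqrt (4 * (K t)\<^sup>2) = 2 * K t" using K_pos[of t] by (simp add: real_sqrt_mult)
    moreover have "1 - (cos (2 * x t))\<^sup>2 = (sin (2 * x t))\<^sup>2" by (simp add: sin_squared_eq)
    ultimately have "angle_density a m (\<psi> t) = S / (2 * a) * (2 * K t / (sin (2 * x t))\<^sup>2)"
      unfolding angle_density_def psi(3)[symmetric] K_squared[symmetric] S_eq[symmetric] by simp
    then show ?thesis using a K_pos[of t] by (simp add: omega_def theta'_eq power2_eq_square)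
  qed
  have "((\<lambda>t. F (\<psi> t) - c t $ 2) has_real_derivative 0) (at t)" for t
    by (rule derivative_eq_intros DERIV_chain2[OF F(2)] psi derivs refl)+ (simp add: dens)
  from DERIV_isconst_all[OF allI[OF this], of t 0] have Fb: "F (\<psi> t) = b"
    by (simp add: psi c0 t F)
  \<comment> \<open>A positive angle means a positive phase, which rules out the multiples of pi
    with index at most 0.\<close>
  have pos: "\<psi> t > 0" using Fb F(1,3) b by (metis strict_mono_less)
  have "rho' t = 0 \<longleftrightarrow> sin (\<psi> t) = 0"
    using psi(4)[of t] sin_pos[of t] a S_pos m by (metis less_irrefl mult_eq_0_iff pi_neq_zero)
  also have "\<dots> \<longleftrightarrow> (\<exists>j\<ge>1. \<psi> t = real j * pi)"
  proof
    assume "sin (\<psi> t) = 0"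
    then obtain i :: int where i: "\<psi> t = of_int i * pi" by (auto simp: sin_zero_iff_int2)
    with pos have "i > 0" by (simp add: zero_less_mult_iff)
    then show "\<exists>j\<ge>1. \<psi> t = real j * pi" using i by (intro exI[of _ "nat i"]) auto
  qed auto
  also have "\<dots> \<longleftrightarrow> (\<exists>j\<ge>1. real j * half_period_angle a m = b)"
    unfolding F(4)[symmetric] Fb[symmetric] strict_mono_eq[OF F(3)] by auto
  finally show ?thesis .
qed

end

lemma half_period_angle_0:
  assumes "a > 0"
  shows "half_period_angle a 0 = pi * sqrt (1 + a\<^sup>2) / (2 * a)"
  by (simp add: half_period_angle_def angle_density_def[abs_def] add.commute)

lemma f_map_zero_iff:
  assumes a: "a > 0" and geo: "geodesic_on (Omega_metric a) (polar_domain a) UNIV (\<gamma> a s)"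
    and "\<gamma> a s 0 = vector [b, 0]" "(\<gamma> a s has_vector_derivative vector [0, 1]) (at 0)"
    and k: "k \<ge> 1"
  shows "f_map \<gamma> k a s = 0 \<longleftrightarrow> cos (2 * phi_of a b) = 0 \<or>
    (\<exists>j\<ge>1. real j * half_period_angle a (cos (2 * phi_of a b)) = real k * pi)"
proof -
  interpret g: turning_geodesic a "\<gamma> a s"
    using assms by unfold_locales simp_all
  have m: "cos (2 * phi_of a b) = g.m" by (simp add: g.m_def g.x_def assms)
  have kp: "real k * pi > 0" using k by simp
  have "\<gamma> a s (ell \<gamma> k a s) $ 2 = real k * pi"
    unfolding ell_def using theI'[OF g.theta_crossing[OF kp]] by simp
  moreover have "f_map \<gamma> k a s = g.rho' (ell \<gamma> k a s)"
    unfolding f_map_def by (rule DERIV_imp_deriv[OF g.derivs(1)])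
  ultimately show ?thesis
    using g.rho'_zero g.rho'_zero_iff[OF _ kp] unfolding m by metis
qed

section \<open>Complex extensions of the angle and length integrals\<close>

lemma Re_pos_not_nonpos_Reals: "0 < Re z \<Longrightarrow> z \<notin> \<real>\<^sub>\<le>\<^sub>0"
  by (simp add: complex_nonpos_Reals_iff)

lemma continuous_on_csqrt_compose:
  assumes "continuous_on A f" "\<And>z. z \<in> A \<Longrightarrow> 0 < Re (f z)"
  shows "continuous_on A (\<lambda>z. csqrt (f z))"
  by (rule continuous_on_compose2[OF continuous_on_csqrt assms(1)]) (use assms(2) Re_pos_not_nonpos_Reals in auto)

lemma csqrt_complex_of_real: "x \<ge> 0 \<Longrightarrow> csqrt (complex_of_real x) = of_real (sqrt x)"
  by simp

lemma integral_complex_of_real: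
  fixes f :: "real \<Rightarrow> real"
  assumes "f integrable_on S"
  shows "integral S (\<lambda>t. complex_of_real (f t)) = of_real (integral S f)"
  by (rule integral_unique[OF has_integral_of_real[OF integrable_integral[OF assms]]])

text \<open>\<open>D\<close> is the set of parameters and times at which the integrand behaves well.
  Compactness of the interval (tube lemma) provides a product neighbourhood that works for all times
  at once; there the integral is holomorphic in each variable and jointly continuous.\<close>

lemma holo2_integral_near:
  fixes f :: "complex \<Rightarrow> complex \<Rightarrow> real \<Rightarrow> complex"
  assumes D: "open D" "{(z0, w0)} \<times> {l..u} \<subseteq> D"
    and c: "continuous_on D (\<lambda>((z, w), t). f z w t)"
    and h1: "\<And>w t. (\<lambda>z. f z w t) holomorphic_on {z. ((z, w), t) \<in> D}"
    and h2: "\<And>z t. (\<lambda>w. f z w t) holomorphic_on {w. ((z, w), t) \<in> D}"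
  obtains W where "open W" "(z0, w0) \<in> W" "W \<times> {l..u} \<subseteq> D"
    "holo2 (\<lambda>(z, w). integral {l..u} (f z w)) W"
proof -
  obtain W0 where W0: "(z0, w0) \<in> W0" "open W0" "W0 \<times> {l..u} \<subseteq> D"
    using Elementary_Topology.tube_lemma[OF compact_Icc D] by blast
  obtain A B where AB: "open A" "open B" "(z0, w0) \<in> A \<times> B" "A \<times> B \<subseteq> W0"
    using W0 open_prod_elim by metis
  have sub: "((z, w), t) \<in> D" if "z \<in> A" "w \<in> B" "t \<in> {l..u}" for z w t
    using that AB W0 by blast
  have "holo2 (\<lambda>(z, w). integral {l..u} (f z w)) (A \<times> B)"
  proof (rule holo2I_separately)
    have "continuous_on (A \<times> B) (\<lambda>q. integral (cbox l u) ((\<lambda>(z, w). f z w) q))"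
    proof (rule integral_continuous_on_param)
      have "continuous_on ((A \<times> B) \<times> cbox l u) (\<lambda>((z, w), t). f z w t)"
        by (rule continuous_on_subset[OF c]) (use sub in auto)
      then show "continuous_on ((A \<times> B) \<times> cbox l u) (\<lambda>(q, t). (\<lambda>(z, w). f z w) q t)"
        by (simp add: case_prod_unfold)
    qed
    then show "continuous_on (A \<times> B) (\<lambda>(z, w). integral {l..u} (f z w))"
      by (simp add: case_prod_unfold)
  next
    fix z w assume "(z, w) \<in> A \<times> B"
    then have zw: "z \<in> A" "w \<in> B" by auto
    have "(\<lambda>z. integral {l..u} (f z w)) holomorphic_on A"
    proof (rule holomorphic_on_integral_param[OF AB(1)])
      have "continuous_on (A \<times> {l..u}) (\<lambda>q. (\<lambda>((z, w), t). f z w t) ((fst q, w), snd q))"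
        by (rule continuous_on_compose2[OF c]) (use sub zw in \<open>auto intro!: continuous_intros\<close>)
      then show "continuous_on (A \<times> {l..u}) (\<lambda>(z, t). f z w t)" by (simp add: case_prod_unfold)
      show "(\<lambda>z. f z w t) holomorphic_on A" if "t \<in> {l..u}" for t
        by (rule holomorphic_on_subset[OF h1]) (use sub zw that in auto)
    qed
    then show "(\<lambda>x. case (x, w) of (z, w) \<Rightarrow> integral {l..u} (f z w)) field_differentiable at z"
      using holomorphic_on_imp_differentiable_at[OF _ AB(1) zw(1)] by simp
    have "(\<lambda>w. integral {l..u} (f z w)) holomorphic_on B"
    proof (rule holomorphic_on_integral_param[OF AB(2)])
      have "continuous_on (B \<times> {l..u}) (\<lambda>q. (\<lambda>((z, w), t). f z w t) ((z, fst q), snd q))"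
        by (rule continuous_on_compose2[OF c]) (use sub zw in \<open>auto intro!: continuous_intros\<close>)
      then show "continuous_on (B \<times> {l..u}) (\<lambda>(w, t). f z w t)" by (simp add: case_prod_unfold)
      show "(\<lambda>w. f z w t) holomorphic_on B" if "t \<in> {l..u}" for t
        by (rule holomorphic_on_subset[OF h2]) (use sub zw that in auto)
    qed
    then show "(\<lambda>y. case (z, y) of (z, w) \<Rightarrow> integral {l..u} (f z w)) field_differentiable at w"
      using holomorphic_on_imp_differentiable_at[OF _ AB(2) zw(2)] by simp
  qed (use AB in \<open>auto intro: open_Times\<close>)
  then show ?thesis
    using that[of "A \<times> B"] AB W0 by (auto intro: open_Times)
qed

lemma half_period_angle_complex_extension:
  assumes a0: "a0 > 0"
  obtains H W where "open W" "(of_real a0, 0) \<in> W" "holo2 H W"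
    "\<And>a m. (of_real a, of_real m) \<in> W \<Longrightarrow>
       a > 0 \<and> \<bar>m\<bar> < 1 \<and> H (of_real a, of_real m) = of_real (half_period_angle a m)"
proof -
  define E :: "complex \<Rightarrow> complex \<Rightarrow> real \<Rightarrow> complex" where
    "E z w p = (1 + w * of_real (cos p)) * (z\<^sup>2 * (1 + w * of_real (cos p)) + (1 - w * of_real (cos p)))" for z w p
  define f where "f z w p = csqrt (1 - w\<^sup>2) / (2 * z) * (csqrt (E z w p) / (1 - (w * of_real (cos p))\<^sup>2))" for z w p
  \<comment> \<open>\<open>E\<close> complexifies the radicand of \<open>angle_density\<close>. A
    positive real part keeps it off the cut of \<open>csqrt\<close>; norm w < 1 does the same for 1
    - w^2 and keeps the denominator nonzero, and Re z > 0 excludes z = 0.\<close>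
  define D where "D = {q :: (complex \<times> complex) \<times> real. 0 < Re (fst (fst q)) \<and> norm (snd (fst q)) < 1
     \<and> 0 < Re (E (fst (fst q)) (snd (fst q)) (snd q))}"
  have cE: "continuous_on A (\<lambda>q. E (fst (fst q)) (snd (fst q)) (snd q))" for A
    unfolding E_def by (intro continuous_intros)
  have Dm: "((z, w), p) \<in> D \<longleftrightarrow> 0 < Re z \<and> norm w < 1 \<and> 0 < Re (E z w p)" for z w p
    by (simp add: D_def)
  have oD: "open D" unfolding D_def
    by (intro open_Collect_conj open_Collect_less continuous_intros cE)
  have 1: "Re (w\<^sup>2) < 1" if "norm w < 1" for w :: complex
  proof -
    have "Re (w\<^sup>2) \<le> (norm w)\<^sup>2" using complex_Re_le_cmod[of "w\<^sup>2"] by (simp add: norm_power)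
    moreover have "(norm w)\<^sup>2 < 1" using that by (simp add: abs_square_less_1)
    ultimately show ?thesis by simp
  qed
  have 2: "(w * of_real (cos p))\<^sup>2 \<noteq> 1" if "norm w < 1" for w :: complex and p :: real
  proof -
    have "norm (w * of_real (cos p)) < 1"
      using abs_mult_cos_less_1[of "norm w" p] that by (simp add: norm_mult abs_mult)
    from 1[OF this] show ?thesis by auto
  qed
  obtain W where W: "open W" "(of_real a0, 0) \<in> W" "W \<times> {0..pi} \<subseteq> D"
    "holo2 (\<lambda>(z, w). integral {0..pi} (f z w)) W"
  proof (rule holo2_integral_near[of D "of_real a0" 0 0 pi f])
    show "{(complex_of_real a0, 0)} \<times> {0..pi} \<subseteq> D"
      using a0 by (auto simp: D_def E_def add_nonneg_pos simp flip: of_real_power)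
    show "continuous_on D (\<lambda>((z, w), t). f z w t)"
      unfolding case_prod_unfold f_def
      by (intro continuous_intros continuous_on_csqrt_compose cE) (auto simp: Dm 1 2)
    have E1: "(\<lambda>z. E z w t) holomorphic_on A" "(\<lambda>z. E w z t) holomorphic_on A" for w t A
      unfolding E_def by (intro holomorphic_intros)+
    show "(\<lambda>z. f z w t) holomorphic_on {z. ((z, w), t) \<in> D}" for w t
      unfolding f_def
      by (intro holomorphic_intros holomorphic_on_csqrt' E1) (auto simp: Dm 1 2 Re_pos_not_nonpos_Reals)
    show "(\<lambda>w. f z w t) holomorphic_on {w. ((z, w), t) \<in> D}" for z t
      unfolding f_def
      by (intro holomorphic_intros holomorphic_on_csqrt' E1) (auto simp: Dm 1 2 Re_pos_not_nonpos_Reals)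
  qed (use oD in auto)
  show ?thesis
  proof (rule that[OF W(1,2,4)])
    fix a m assume "(complex_of_real a, complex_of_real m) \<in> W"
    then have "((complex_of_real a, complex_of_real m), p) \<in> D" if "p \<in> {0..pi}" for p
      using W(3) that by blast
    then have am: "a > 0" "\<bar>m\<bar> < 1" and E: "0 < Re (E a m p)" if "p \<in> {0..pi}" for p
      using that by (auto simp: Dm)
    have a: "a > 0" "\<bar>m\<bar> < 1" using am[of 0] by auto
    have Er: "E a m p = of_real ((1 + m * cos p) * (a\<^sup>2 * (1 + m * cos p) + (1 - m * cos p)))" for p
      by (simp add: E_def)
    have "f a m p = of_real (angle_density a m p)" if p: "p \<in> {0..pi}" for p
    proof -
      have 3: "m\<^sup>2 < 1" using a by (simp add: abs_square_less_1)
      have "csqrt (E a m p) = of_real (sqrt ((1 + m * cos p) * (a\<^sup>2 * (1 + m * cos p) + (1 - m * cos p))))"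
        using E[OF p] unfolding Er by (intro csqrt_complex_of_real) simp
      moreover have "csqrt (1 - (of_real m)\<^sup>2) = of_real (sqrt (1 - m\<^sup>2))"
        using csqrt_complex_of_real[of "1 - m\<^sup>2"] 3 by simp
      ultimately show ?thesis by (simp add: f_def angle_density_def)
    qed
    then have "integral {0..pi} (f a m) = integral {0..pi} (\<lambda>p. complex_of_real (angle_density a m p))"
      by (intro integral_cong) simp
    also have "\<dots> = of_real (half_period_angle a m)"
      unfolding half_period_angle_def
      by (intro integral_complex_of_real integrable_continuous_real continuous_at_imp_continuous_on)
        (use continuous_angle_density[OF a] in blast)
    finally show "a > 0 \<and> \<bar>m\<bar> < 1 \<and> (\<lambda>(z, w). integral {0..pi} (f z w)) (of_real a, of_real m)
        = of_real (half_period_angle a m)"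
      using a by simp
  qed
qed

text \<open>Substituting \<open>sin \<xi> = v sin x\<close> fixes the integration interval and makes the integrand
  analytic in \<open>sin x\<close>.\<close>

lemma rho_of_eq_integral:
  assumes x: "x \<in> {0..pi / 2}"
  shows "rho_of a x = integral {0..1} (\<lambda>v. 2 * pi * sin x * sqrt (a\<^sup>2 * (1 - (sin x * v)\<^sup>2) + (sin x * v)\<^sup>2))"
proof -
  define p where "p y = sqrt (a\<^sup>2 * (1 - y\<^sup>2) + y\<^sup>2)" for y
  have "isCont p y" for y unfolding p_def by (intro continuous_intros)
  \<comment> \<open>Both integrals are evaluated with the same antiderivative \<open>P\<close>, once
    along sin \<xi> and once along v sin x.\<close>
  then obtain P where P: "P 0 = 0" "\<And>y. (P has_real_derivative p y) (at y)"
    using real_antiderivative by metis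
  have "((\<lambda>\<xi>. cos \<xi> * sqrt (a\<^sup>2 * (cos \<xi>)\<^sup>2 + (sin \<xi>)\<^sup>2)) has_integral P (sin x) - P (sin 0)) {0..x}"
  proof (rule fundamental_theorem_of_calculus)
    fix \<xi> :: real
    have "((\<lambda>\<xi>. P (sin \<xi>)) has_real_derivative cos \<xi> * sqrt (a\<^sup>2 * (cos \<xi>)\<^sup>2 + (sin \<xi>)\<^sup>2)) (at \<xi>)"
      using DERIV_chain2[OF P(2) DERIV_sin, of \<xi>] by (simp add: p_def cos_squared_eq mult.commute)
    then show "((\<lambda>\<xi>. P (sin \<xi>)) has_vector_derivative cos \<xi> * sqrt (a\<^sup>2 * (cos \<xi>)\<^sup>2 + (sin \<xi>)\<^sup>2)) (at \<xi> within {0..x})"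
      by (simp add: has_real_derivative_iff_has_vector_derivative has_vector_derivative_at_within)
  qed (use x in simp)
  then have 1: "rho_of a x = 2 * pi * P (sin x)"
    by (simp add: rho_of_def integral_unique P)
  have "((\<lambda>v. 2 * pi * sin x * p (sin x * v)) has_integral 2 * pi * P (sin x * 1) - 2 * pi * P (sin x * 0)) {0..1}"
  proof (rule fundamental_theorem_of_calculus)
    fix v :: real
    have "((\<lambda>v. 2 * pi * P (sin x * v)) has_real_derivative 2 * pi * sin x * p (sin x * v)) (at v)"
      using DERIV_cmult[OF DERIV_chain2[OF P(2) DERIV_cmult_Id], of "2 * pi" "sin x" v] by (simp add: mult_ac)
    then show "((\<lambda>v. 2 * pi * P (sin x * v)) has_vector_derivative 2 * pi * sin x * p (sin x * v)) (at v within {0..1})"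
      by (simp add: has_real_derivative_iff_has_vector_derivative has_vector_derivative_at_within)
  qed simp
  from integral_unique[OF this] show ?thesis unfolding 1 p_def by (simp add: P)
qed

text \<open>A complex derivative is detected along a real curve: were it zero, the chain rule would
  make the real derivative \<open>e\<close> vanish too. The reparametrisation \<phi> allows a
  holomorphic function of sin x to be tested through the derivative in \<open>x\<close>.\<close>

lemma complex_deriv_nonzero:
  assumes F: "(F has_field_derivative D) (at (of_real (\<phi> t0)))"
    and p: "(\<phi> has_real_derivative d) (at t0)"
    and T: "open T" "t0 \<in> T" "\<And>t. t \<in> T \<Longrightarrow> F (of_real (\<phi> t)) = complex_of_real (h t)"
    and h: "(h has_real_derivative e) (at t0)" "e \<noteq> 0"
  shows "D \<noteq> 0"
proof
  assume "D = 0"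
  have "((\<lambda>t. complex_of_real (\<phi> t)) has_vector_derivative of_real d) (at t0)"
    using p by (simp add: has_real_derivative_iff_has_vector_derivative has_vector_derivative_of_real)
  from field_vector_diff_chain_at[OF this F] \<open>D = 0\<close>
  have "((\<lambda>t. F (of_real (\<phi> t))) has_vector_derivative 0) (at t0)" by (simp add: o_def)
  then have "((\<lambda>t. complex_of_real (h t)) has_vector_derivative 0) (at t0)"
    by (rule has_vector_derivative_transform_within_open[OF _ T(1,2)]) (use T(3) in simp)
  moreover have "((\<lambda>t. complex_of_real (h t)) has_vector_derivative of_real e) (at t0)"
    using h by (simp add: has_real_derivative_iff_has_vector_derivative has_vector_derivative_of_real)
  ultimately have "complex_of_real e = 0" by (rule vector_derivative_unique_at[symmetric])
  with h show False by simp
qed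

text \<open>Holomorphy is only local, but the values at real points are correct for all a > 0 and
  all angles: the integral formula has a positive radicand there, so \<open>csqrt\<close> is the
  real root.\<close>

lemma rho_of_complex_extension:
  assumes a0: "a0 > 0"
  obtains R W where "open W" "(of_real (sin (pi / 4)), of_real a0) \<in> W" "holo2 R W"
    "\<And>a x. a > 0 \<Longrightarrow> x \<in> {0..pi / 2} \<Longrightarrow> R (of_real (sin x), of_real a) = of_real (rho_of a x)"
proof -
  define E :: "complex \<Rightarrow> complex \<Rightarrow> real \<Rightarrow> complex" where
    "E y z v = z\<^sup>2 * (1 - (y * of_real v)\<^sup>2) + (y * of_real v)\<^sup>2" for y z v
  define f where "f y z v = 2 * of_real pi * y * csqrt (E y z v)" for y z v
  define D where "D = {q :: (complex \<times> complex) \<times> real. 0 < Re (E (fst (fst q)) (snd (fst q)) (snd q))}"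
  have cE: "continuous_on A (\<lambda>q. E (fst (fst q)) (snd (fst q)) (snd q))" for A
    unfolding E_def by (intro continuous_intros)
  have Dm: "((z, w), p) \<in> D \<longleftrightarrow> 0 < Re (E z w p)" for z w p
    by (simp add: D_def)
  have oD: "open D" unfolding D_def by (intro open_Collect_less continuous_intros cE)
  have Er: "E (of_real y) (of_real z) v = of_real (z\<^sup>2 * (1 - (y * v)\<^sup>2) + (y * v)\<^sup>2)" for y z v
    by (simp add: E_def)
  \<comment> \<open>Writing y as a sine reduces this to \<open>speed_pos\<close>.\<close>
  have pos: "0 < a\<^sup>2 * (1 - y\<^sup>2) + y\<^sup>2" if "a > 0" "\<bar>y\<bar> \<le> 1" for a y :: real
    using speed_pos[OF that(1), of "arcsin y"] that(2)
    by (simp add: cos_squared_eq)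
  have ab: "\<bar>sin x * v\<bar> \<le> 1" if "v \<in> {0..1}" for x v :: real
    using that mult_mono[OF abs_sin_le_one[of x], of v 1] by (simp add: abs_mult)
  obtain W where W: "open W" "(of_real (sin (pi / 4)), of_real a0) \<in> W" "W \<times> {0..1} \<subseteq> D"
    "holo2 (\<lambda>(z, w). integral {0..1} (f z w)) W"
  proof (rule holo2_integral_near[of D "of_real (sin (pi / 4))" "of_real a0" 0 1 f])
    show "{(complex_of_real (sin (pi / 4)), complex_of_real a0)} \<times> {0..1} \<subseteq> D"
      using pos[OF a0 ab, of _ "pi / 4"] by (clarsimp simp only: Dm Er Re_complex_of_real)
    show "continuous_on D (\<lambda>((z, w), t). f z w t)"
      unfolding case_prod_unfold f_def
      by (intro continuous_intros continuous_on_csqrt_compose cE) (auto simp: Dm)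
    have E1: "(\<lambda>z. E z w t) holomorphic_on A" "(\<lambda>z. E w z t) holomorphic_on A" for w t A
      unfolding E_def by (intro holomorphic_intros)+
    show "(\<lambda>z. f z w t) holomorphic_on {z. ((z, w), t) \<in> D}" for w t
      unfolding f_def
      by (intro holomorphic_intros holomorphic_on_csqrt' E1) (auto simp: Dm Re_pos_not_nonpos_Reals)
    show "(\<lambda>w. f z w t) holomorphic_on {w. ((z, w), t) \<in> D}" for z t
      unfolding f_def
      by (intro holomorphic_intros holomorphic_on_csqrt' E1) (auto simp: Dm Re_pos_not_nonpos_Reals)
  qed (use oD in auto)
  show ?thesis
  proof (rule that[OF W(1,2,4)])
    fix a x :: real assume a: "a > 0" and x: "x \<in> {0..pi / 2}"
    let ?g = "\<lambda>v. 2 * pi * sin x * sqrt (a\<^sup>2 * (1 - (sin x * v)\<^sup>2) + (sin x * v)\<^sup>2)"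
    have "f (of_real (sin x)) (of_real a) v = of_real (?g v)" if "v \<in> {0..1}" for v
      unfolding f_def Er using pos[OF a ab[OF that, of x]]
      by (subst csqrt_complex_of_real) simp_all
    then have "integral {0..1} (f (of_real (sin x)) (of_real a)) = integral {0..1} (\<lambda>v. complex_of_real (?g v))"
      by (intro integral_cong) simp
    also have "\<dots> = of_real (rho_of a x)"
      unfolding rho_of_eq_integral[OF x]
      by (intro integral_complex_of_real integrable_continuous_real continuous_intros)
    finally show "(\<lambda>(z, w). integral {0..1} (f z w)) (of_real (sin x), of_real a) = of_real (rho_of a x)"
      by simp
  qed
qed

lemma continuous_on_complex_of_real_pair:
  "continuous_on A (\<lambda>p. (complex_of_real (fst p), complex_of_real (snd p)))"
  by (intro continuous_intros)

lemma real_analytic2_imp_continuous_on: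
  assumes "real_analytic2_on h S"
  shows "continuous_on S h"
proof (rule continuous_at_imp_continuous_on, rule ballI)
  fix p assume "p \<in> S"
  obtain x0 y0 where p: "p = (x0, y0)" by force
  obtain H W where W: "open W" "(of_real x0, of_real y0) \<in> W" "holo2 H W"
    "\<And>x y. (of_real x, of_real y) \<in> W \<Longrightarrow> H (of_real x, of_real y) = of_real (h (x, y))"
  proof (rule real_analytic2_complex_extension[OF assms, of x0 y0])
    show "(x0, y0) \<in> S" using \<open>p \<in> S\<close> p by simp
  qed (rule that)
  let ?e = "\<lambda>p. (complex_of_real (fst p), complex_of_real (snd p))"
  have o: "open (?e -` W)" by (intro open_vimage W continuous_on_complex_of_real_pair)
  have "continuous_on (?e -` W) (\<lambda>p. Re (H (?e p)))"
    by (rule continuous_on_Re, rule continuous_on_compose2[OF holo2_imp_continuous_on[OF W(3)]],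
        rule continuous_on_complex_of_real_pair) auto
  then have "continuous_on (?e -` W) h"
    by (rule continuous_on_eq) (auto simp: W(4))
  then show "continuous (at p) h"
    using o W(2) p by (simp add: continuous_on_eq_continuous_at)
qed

lemma open_param_domain: "open param_domain"
  unfolding param_domain_def by (intro open_Times) auto

lemma continuous_on_rho_of_param: "continuous_on A (\<lambda>a. rho_of a x)"
proof -
  have "continuous_on A (\<lambda>a. integral (cbox 0 x) (\<lambda>\<xi>. cos \<xi> * sqrt (a\<^sup>2 * (cos \<xi>)\<^sup>2 + (sin \<xi>)\<^sup>2)))"
    by (rule integral_continuous_on_param) (auto simp: case_prod_unfold intro!: continuous_intros)
  then show ?thesis unfolding rho_of_def by (intro continuous_intros) simp
qed

text \<open>A substitute for joint continuity of \<open>phi_of\<close> in (a, r): bracketing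
  \<open>r\<close> between two values of \<open>rho_of a\<close>, which depend continuously on
  \<open>a\<close>, localises the angle.\<close>

lemma phi_of_bounds:
  assumes a: "a > 0" and r: "0 < r" "r < L_len a"
    and xy: "x \<in> {0..pi / 2}" "y \<in> {0..pi / 2}" "rho_of a x < r" "r < rho_of a y"
  shows "x < phi_of a r" "phi_of a r < y"
proof -
  obtain z where z: "0 < z" "z < pi / 2" "rho_of a z = r" "phi_of a r = z"
    using polar_angle_exists[OF a r] .
  note mono = strict_mono_on_less[OF rho_of_strict_mono[OF a]]
  have "x < z" using mono[of x z] xy z by simp
  moreover have "z < y" using mono[of z y] xy z by simp
  ultimately show "x < phi_of a r" "phi_of a r < y" using z by auto
qed

section \<open>The turning angle as a function of the parameters (a, s)\<close>

definition turn_angle :: "(real \<Rightarrow> real \<Rightarrow> real) \<Rightarrow> real \<Rightarrow> real \<Rightarrow> real" where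
  "turn_angle \<beta> a s = half_period_angle a (cos (2 * phi_of a (\<beta> a s)))"

lemma turn_angle_0:
  assumes "a > 0" "\<beta> a 0 = rho_zero a"
  shows "turn_angle \<beta> a 0 = pi * sqrt (1 + a\<^sup>2) / (2 * a)"
  using assms by (simp add: turn_angle_def rho_zero_eq phi_of_rho_of half_period_angle_0)

text \<open>A composition of four extensions: \<beta> in (a, s); then sin (phi_of a \<rho>), as the
  local inverse of \<open>R\<close> in its first variable; then cos (2 x) = 1 - 2 sin^2 x; and
  finally the half period angle in (a, m).\<close>

lemma turn_angle_complex_extension:
  assumes analytic: "real_analytic2_on (\<lambda>(a, s). \<beta> a s) param_domain"
    and range: "\<And>a s. (a, s) \<in> param_domain \<Longrightarrow> \<beta> a s \<in> {0<..<L_len a}"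
    and zero: "\<And>a. a > 0 \<Longrightarrow> \<beta> a 0 = rho_zero a"
    and a0: "a0 > 0"
  obtains H W where "open W" "(of_real a0, 0) \<in> W" "holo2 H W"
    "\<And>a s. (of_real a, of_real s) \<in> W \<Longrightarrow>
       (a, s) \<in> param_domain \<and> H (of_real a, of_real s) = of_real (turn_angle \<beta> a s)"
proof -
  obtain H1 W1 where H1: "open W1" "(of_real a0, 0) \<in> W1" "holo2 H1 W1"
    "\<And>a m. (of_real a, of_real m) \<in> W1 \<Longrightarrow>
       a > 0 \<and> \<bar>m\<bar> < 1 \<and> H1 (of_real a, of_real m) = of_real (half_period_angle a m)"
    using half_period_angle_complex_extension[OF a0] by metis
  let ?y = "sin (pi / 4) :: real"
  obtain R W2 where R: "open W2" "(of_real ?y, of_real a0) \<in> W2" "holo2 R W2"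
    "\<And>a x. a > 0 \<Longrightarrow> x \<in> {0..pi / 2} \<Longrightarrow> R (of_real (sin x), of_real a) = of_real (rho_of a x)"
    using rho_of_complex_extension[OF a0] by metis
  obtain B W3 where B: "open W3" "(of_real a0, of_real 0) \<in> W3" "holo2 B W3"
    "\<And>a s. (of_real a, of_real s) \<in> W3 \<Longrightarrow> B (of_real a, of_real s) = of_real ((\<lambda>(a, s). \<beta> a s) (a, s))"
  proof (rule real_analytic2_complex_extension[OF analytic])
    show "(a0, 0) \<in> param_domain" using a0 by (simp add: param_domain_def)
  qed (rule that)
  have nz: "deriv (\<lambda>y. R (y, of_real a0)) (of_real ?y) \<noteq> 0"
  proof (rule complex_deriv_nonzero[of _ _ sin "pi / 4" _ "{0<..<pi / 2}" "rho_of a0"])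
    show "((\<lambda>y. R (y, of_real a0)) has_field_derivative deriv (\<lambda>y. R (y, of_real a0)) (of_real ?y)) (at (of_real ?y))"
      by (rule has_derivative_imp_partial_derivs(1)[OF holo2_has_derivative[OF R(3,2)]])
    show "(sin has_real_derivative cos (pi / 4)) (at (pi / 4))" by (rule DERIV_sin)
    have "at (pi / 4) within {0..pi / 2} = at (pi / 4 :: real)"
      by (intro at_within_interior) simp
    then show "(rho_of a0 has_real_derivative 2 * pi * (cos (pi / 4) * sqrt (a0\<^sup>2 * (cos (pi / 4))\<^sup>2 + (sin (pi / 4))\<^sup>2))) (at (pi / 4))"
      using rho_of_has_derivative[of "pi / 4" a0] by simp
    show "2 * pi * (cos (pi / 4) * sqrt (a0\<^sup>2 * (cos (pi / 4))\<^sup>2 + (sin (pi / 4))\<^sup>2)) \<noteq> 0"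
      using speed_pos[OF a0, of "pi / 4"] cos_gt_zero[of "pi / 4"] by simp
  qed (use R(4)[OF a0] in auto)
  obtain U V g where g: "open U" "U \<subseteq> W2" "(of_real ?y, of_real a0) \<in> U" "open V"
    "(R (of_real ?y, of_real a0), of_real a0) \<in> V" "holo2 g V"
    "\<And>z w. (z, w) \<in> U \<Longrightarrow> (R (z, w), w) \<in> V \<and> g (R (z, w), w) = z"
    using holo2_inverse[OF R(3,1,2) nz] by metis

  define U' where "U' = (\<lambda>p. (complex_of_real (sin (fst p)), complex_of_real (snd p))) -` U"
  have "open U'" unfolding U'_def by (intro open_vimage g continuous_intros)
  moreover have "(pi / 4, a0) \<in> U'" using g(3) by (simp add: U'_def)
  ultimately obtain X Y where XY: "open X" "open Y" "(pi / 4, a0) \<in> X \<times> Y" "X \<times> Y \<subseteq> U'"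
    using open_prod_elim by metis
  obtain e where e: "e > 0" "ball (pi / 4) e \<subseteq> X" using XY open_contains_ball by blast
  define d where "d = min e (pi / 8)"
  have d: "0 < d" "d \<le> e" "d < pi / 4" using e pi_gt_zero unfolding d_def by linarith+
  \<comment> \<open>The two positivity conditions place \<beta> a s between the lengths at the
    angles pi/4 - d and pi/4 + d. They force sin (phi_of a (\<beta> a s)) into the region where
    \<open>g\<close> is known to invert \<open>R\<close>, so that \<open>g\<close> picks the right
    solution.\<close>
  define N where "N = param_domain \<inter> (\<lambda>p. (fst p, (\<lambda>(a, s). \<beta> a s) p - rho_of (fst p) (pi / 4 - d),
      rho_of (fst p) (pi / 4 + d) - (\<lambda>(a, s). \<beta> a s) p)) -` (Y \<times> {0<..} \<times> {0<..})"
  have "open N" unfolding N_def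
    by (intro continuous_open_preimage continuous_on_Pair continuous_on_diff open_param_domain
        real_analytic2_imp_continuous_on[OF analytic] open_Times XY continuous_on_fst continuous_on_id
        continuous_on_compose2[OF continuous_on_rho_of_param[of UNIV]] open_greaterThan subset_UNIV)
  have N0: "(a0, 0) \<in> N"
  proof -
    note mono = strict_mono_onD[OF rho_of_strict_mono[OF a0]]
    have "rho_of a0 (pi / 4 - d) < rho_of a0 (pi / 4)" "rho_of a0 (pi / 4) < rho_of a0 (pi / 4 + d)"
      by (rule mono; use d in simp)+
    then show ?thesis
      using a0 XY by (simp add: N_def param_domain_def zero rho_zero_eq)
  qed
  have N: "(a, s) \<in> param_domain" "phi_of a (\<beta> a s) \<in> {0..pi / 2}"
      "(of_real (sin (phi_of a (\<beta> a s))), of_real a) \<in> U" "rho_of a (phi_of a (\<beta> a s)) = \<beta> a s"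
    if as: "(a, s) \<in> N" for a s
  proof -
    show dom: "(a, s) \<in> param_domain" using as by (simp add: N_def)
    then have a: "a > 0" by (simp add: param_domain_def)
    have r: "0 < \<beta> a s" "\<beta> a s < L_len a" using range[OF dom] by auto
    have 1: "pi / 4 - d < phi_of a (\<beta> a s)" "phi_of a (\<beta> a s) < pi / 4 + d"
      using phi_of_bounds[OF a r, of "pi / 4 - d" "pi / 4 + d"] as d by (auto simp: N_def)
    have "phi_of a (\<beta> a s) \<in> X" using 1 d e by (auto simp: dist_real_def)
    moreover have "a \<in> Y" using as by (simp add: N_def)
    ultimately show "(of_real (sin (phi_of a (\<beta> a s))), of_real a) \<in> U"
      using XY(4) unfolding U'_def by auto
    show "phi_of a (\<beta> a s) \<in> {0..pi / 2}" "rho_of a (phi_of a (\<beta> a s)) = \<beta> a s"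
      using polar_angle_exists[OF a r] by (metis atLeastAtMost_iff less_imp_le)+
  qed

  define G where "G p = 1 - 2 * (g (B p, fst p))\<^sup>2" for p
  define W4 where "W4 = W3 \<inter> (\<lambda>p. (B p, fst p)) -` V"
  define W5 where "W5 = W4 \<inter> (\<lambda>p. (fst p, G p)) -` W1"
  \<comment> \<open>\<open>N\<close> is a condition on real parameters. Imposing it on real parts
    keeps the set open and says exactly (a, s) \<in> N at real points.\<close>
  define W where "W = W5 \<inter> (\<lambda>p. (Re (fst p), Re (snd p))) -` N"
  have cB: "continuous_on W3 (\<lambda>p. (B p, fst p))"
    by (intro continuous_intros holo2_imp_continuous_on[OF B(3)])
  have o4: "open W4" unfolding W4_def
    by (rule continuous_open_preimage[OF cB B(1) g(4)])
  have hg: "holo2 (\<lambda>p. g (B p, fst p)) W4"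
    by (rule holo2_compose[OF g(6)]) (auto simp: W4_def holo2_fst intro: holo2_subset[OF B(3)])
  have hG: "holo2 G W4" unfolding G_def
    by (rule holo2_compose1[OF _ open_UNIV hg, of "\<lambda>y. 1 - 2 * y\<^sup>2"]) (auto intro!: holomorphic_intros)
  have o5: "open W5" unfolding W5_def
    by (intro continuous_open_preimage continuous_intros holo2_imp_continuous_on[OF hG] o4 H1)
  have o: "open W" unfolding W_def
    by (intro continuous_open_preimage continuous_intros o5 \<open>open N\<close>)
  have gB: "g (B (of_real a, of_real s), of_real a) = of_real (sin (phi_of a (\<beta> a s)))"
    and RB: "(B (of_real a, of_real s), of_real a) \<in> V"
    if as: "(a, s) \<in> N" "(of_real a, of_real s) \<in> W3" for a s
  proof -
    have "R (of_real (sin (phi_of a (\<beta> a s))), of_real a) = B (of_real a, of_real s)"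
      using R(4)[of a "phi_of a (\<beta> a s)"] N[OF as(1)] B(4)[OF as(2)] by (simp add: param_domain_def)
    then show "g (B (of_real a, of_real s), of_real a) = of_real (sin (phi_of a (\<beta> a s)))"
      "(B (of_real a, of_real s), of_real a) \<in> V"
      using g(7)[OF N(3)[OF as(1)]] by simp_all
  qed
  have Gr: "G (of_real a, of_real s) = of_real (cos (2 * phi_of a (\<beta> a s)))"
    if "(a, s) \<in> N" "(of_real a, of_real s) \<in> W3" for a s
    unfolding G_def fst_conv gB[OF that] by (simp add: cos_double_sin)
  show ?thesis
  proof (rule that[OF o])
    have "cos (2 * phi_of a0 (\<beta> a0 0)) = 0"
      using a0 by (simp add: zero rho_zero_eq phi_of_rho_of)
    then show "(of_real a0, 0) \<in> W"
      using RB[OF N0 B(2)] Gr[OF N0 B(2)] B(2) N0 H1(2)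
      by (simp add: W_def W5_def W4_def)
    show "holo2 (\<lambda>p. H1 (fst p, G p)) W"
      by (rule holo2_compose[OF H1(3) holo2_fst])
        (auto simp: W_def W5_def intro: holo2_subset[OF hG])
    fix a s assume as: "(complex_of_real a, complex_of_real s) \<in> W"
    then have n: "(a, s) \<in> N" "(of_real a, of_real s) \<in> W3" "(of_real a, G (of_real a, of_real s)) \<in> W1"
      by (auto simp: W_def W5_def W4_def)
    then show "(a, s) \<in> param_domain \<and> H1 (fst (complex_of_real a, complex_of_real s), G (of_real a, of_real s))
        = of_real (turn_angle \<beta> a s)"
      using N(1)[OF n(1)] H1(4)[of a "cos (2 * phi_of a (\<beta> a s))"] Gr[OF n(1,2)]
      by (simp add: turn_angle_def)
  qed
qed

text \<open>Squaring leads to j^2 = a^2 (4 k^2 - j^2). This is solvable exactly for j < 2 k, whence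
  the range of \<open>j\<close>, and \<open>a_bif k j\<close> is the positive root.\<close>

lemma a_bif_iff:
  assumes a: "a > 0" and k: "k \<ge> 1" and j: "j \<ge> 1"
  shows "real j * (pi * sqrt (1 + a\<^sup>2) / (2 * a)) = real k * pi \<longleftrightarrow> j < 2 * k \<and> a = a_bif k j"
proof -
  have "real j * (pi * sqrt (1 + a\<^sup>2) / (2 * a)) = real k * pi \<longleftrightarrow> real j * sqrt (1 + a\<^sup>2) = 2 * real k * a"
    using a by (simp add: field_simps)
  also have "\<dots> \<longleftrightarrow> (real j * sqrt (1 + a\<^sup>2))\<^sup>2 = (2 * real k * a)\<^sup>2"
    using a by (subst power2_eq_iff_nonneg) auto
  also have "\<dots> \<longleftrightarrow> (real j)\<^sup>2 = a\<^sup>2 * (4 * (real k)\<^sup>2 - (real j)\<^sup>2)"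
    by (auto simp: power_mult_distrib algebra_simps)
  also have "\<dots> \<longleftrightarrow> j < 2 * k \<and> a = a_bif k j"
  proof (cases "j < 2 * k")
    case False
    then have "2 * real k \<le> real j" by linarith
    then have "(2 * real k)\<^sup>2 \<le> (real j)\<^sup>2" by (intro power_mono) auto
    then have "a\<^sup>2 * (4 * (real k)\<^sup>2 - (real j)\<^sup>2) \<le> 0"
      by (intro mult_nonneg_nonpos) (auto simp: power_mult_distrib)
    moreover have "(real j)\<^sup>2 > 0" using j by simp
    ultimately show ?thesis using False by linarith
  next
    case True
    define q where "q = real j / real k"
    have q: "0 < q" "q < 2" using True j k by (auto simp: q_def field_simps)
    then have q2: "q\<^sup>2 < 4" using power_strict_mono[of q 2 2] by simp
    have jk: "real j = q * real k" using k by (simp add: q_def)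
    have "(real j)\<^sup>2 = a\<^sup>2 * (4 * (real k)\<^sup>2 - (real j)\<^sup>2) \<longleftrightarrow> (real k)\<^sup>2 * q\<^sup>2 = (real k)\<^sup>2 * (a\<^sup>2 * (4 - q\<^sup>2))"
      unfolding jk by (simp add: power_mult_distrib algebra_simps)
    also have "\<dots> \<longleftrightarrow> q\<^sup>2 = a\<^sup>2 * (4 - q\<^sup>2)" using k by simp
    also have "\<dots> \<longleftrightarrow> a\<^sup>2 = (q / sqrt (4 - q\<^sup>2))\<^sup>2"
      using q2 by (auto simp: power_divide field_simps)
    also have "\<dots> \<longleftrightarrow> a = q / sqrt (4 - q\<^sup>2)"
      using a q q2 by (subst power2_eq_iff_nonneg) auto
    finally show ?thesis using True by (simp add: a_bif_def q_def)
  qed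
  finally show ?thesis .
qed

lemma a_bif_pos:
  assumes "0 < j" "j < 2 * k"
  shows "a_bif k j > 0"
proof -
  define q where "q = real j / real k"
  have q: "0 < q" "q < 2" using assms by (auto simp: q_def field_simps)
  then have "q\<^sup>2 < 4" using power_strict_mono[of q 2 2] by simp
  with q show ?thesis by (simp add: a_bif_def flip: q_def)
qed

lemma limit_angle_strict_decreasing:
  assumes "0 < a" "a < b"
  shows "pi * sqrt (1 + b\<^sup>2) / (2 * b) < pi * sqrt (1 + a\<^sup>2) / (2 * a)"
proof -
  \<comment> \<open>In this form the monotonicity is visible.\<close>
  have e: "pi * sqrt (1 + x\<^sup>2) / (2 * x) = pi / 2 * sqrt (1 / x\<^sup>2 + 1)" if "x > 0" for x :: real
  proof -
    have "1 / x\<^sup>2 + 1 = (1 + x\<^sup>2) / x\<^sup>2" using that by (simp add: field_simps)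
    then show ?thesis using that by (simp add: real_sqrt_divide)
  qed
  have "1 / b\<^sup>2 < 1 / a\<^sup>2"
    using assms by (intro divide_strict_left_mono power_strict_mono) auto
  then show ?thesis using assms by (simp add: e)
qed

lemma limit_angle_has_derivative:
  assumes a: "a > 0"
  shows "((\<lambda>a. pi * sqrt (1 + a\<^sup>2) / (2 * a)) has_real_derivative - (pi / (2 * a\<^sup>2 * sqrt (1 + a\<^sup>2)))) (at a)"
proof -
  define s where "s = sqrt (1 + a\<^sup>2)"
  have s: "s > 0" "s\<^sup>2 = 1 + a\<^sup>2" by (auto simp: s_def add_pos_nonneg)
  have "((\<lambda>a. pi * sqrt (1 + a\<^sup>2) / (2 * a)) has_real_derivative
      (pi * (inverse s / 2 * (2 * a)) * (2 * a) - pi * s * 2) / ((2 * a) * (2 * a))) (at a)"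
    unfolding s_def using a add_pos_nonneg[OF zero_less_one zero_le_power2[of a]]
    by (auto intro!: derivative_eq_intros)
  moreover have "(pi * (inverse s / 2 * (2 * a)) * (2 * a) - pi * s * 2) / ((2 * a) * (2 * a))
      = pi * (a\<^sup>2 - s\<^sup>2) / (2 * a\<^sup>2 * s)"
    using a s(1) by (simp add: field_simps power2_eq_square)
  ultimately show ?thesis by (simp add: s s_def[symmetric])
qed

section \<open>The bifurcating branches\<close>

text \<open>An implicit function theorem for the level set of \<open>T\<close> through (a0, 0), on a
  box in which the solution curve never meets the two edges a = a0 - \<eta> and a = a0 + \<eta>. The
  local inverse \<open>g\<close> gives analyticity and uniqueness, the intermediate value theorem
  gives real solutions.\<close>

lemma turn_angle_implicit:
  assumes H: "holo2 H W" "open W" "(of_real a0, 0) \<in> W"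
    and Hr: "\<And>a s. (of_real a, of_real s) \<in> W \<Longrightarrow> H (of_real a, of_real s) = of_real (T a s)"
    and T0: "\<And>a. a > 0 \<Longrightarrow> T a 0 = pi * sqrt (1 + a\<^sup>2) / (2 * a)"
    and a0: "a0 > 0"
    and N: "open N" "(a0, 0) \<in> N"
  obtains \<eta> \<epsilon> A where "\<eta> > 0" "\<epsilon> > 0" "{a0 - \<eta><..<a0 + \<eta>} \<times> {-\<epsilon><..<\<epsilon>} \<subseteq> N"
    "real_analytic_on A {-\<epsilon><..<\<epsilon>}" "A 0 = a0"
    "\<And>s. s \<in> {-\<epsilon><..<\<epsilon>} \<Longrightarrow> A s \<in> {a0 - \<eta><..<a0 + \<eta>}"
    "\<And>a s. a \<in> {a0 - \<eta><..<a0 + \<eta>} \<Longrightarrow> s \<in> {-\<epsilon><..<\<epsilon>} \<Longrightarrow> T a s = T a0 0 \<longleftrightarrow> a = A s"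
proof -
  let ?e = "\<lambda>p. (complex_of_real (fst p), complex_of_real (snd p))"
  define c where "c = T a0 0"
  have Hc: "H (of_real a0, 0) = of_real c" using Hr[of a0 0] H(3) by (simp add: c_def)
  have cT: "continuous_on (?e -` W) (\<lambda>p. T (fst p) (snd p))"
  proof -
    have "continuous_on (?e -` W) (\<lambda>p. Re (H (?e p)))"
      by (rule continuous_on_Re, rule continuous_on_compose2[OF holo2_imp_continuous_on[OF H(1)]],
          rule continuous_on_complex_of_real_pair) auto
    then show ?thesis by (rule continuous_on_eq) (auto simp: Hr)
  qed
  have nz: "deriv (\<lambda>z. H (z, 0)) (of_real a0) \<noteq> 0"
  proof (rule complex_deriv_nonzero[of _ _ "\<lambda>t. t" a0 1 "{0<..} \<inter> {t. (t, 0) \<in> ?e -` W}"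
        "\<lambda>a. pi * sqrt (1 + a\<^sup>2) / (2 * a)"])
    show "((\<lambda>z. H (z, 0)) has_field_derivative deriv (\<lambda>z. H (z, 0)) (of_real a0)) (at (of_real a0))"
      by (rule has_derivative_imp_partial_derivs(1)[OF holo2_has_derivative[OF H(1,3)]])
    have "open ((\<lambda>t. (complex_of_real t, 0 :: complex)) -` W)"
      by (intro open_vimage H continuous_intros)
    moreover have "{t. (t, 0) \<in> ?e -` W} = (\<lambda>t. (complex_of_real t, 0)) -` W" by auto
    ultimately show "open ({0<..} \<inter> {t. (t, 0) \<in> ?e -` W})" by auto
    show "H (of_real t, 0) = of_real (pi * sqrt (1 + t\<^sup>2) / (2 * t))"
      if "t \<in> {0<..} \<inter> {t. (t, 0) \<in> ?e -` W}" for t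
      using Hr[of t 0] T0[of t] that by simp
    have "sqrt (1 + a0\<^sup>2) > 0" by (simp add: add_pos_nonneg)
    then show "- (pi / (2 * a0\<^sup>2 * sqrt (1 + a0\<^sup>2))) \<noteq> 0" using a0 by simp
    show "((\<lambda>t. t) has_real_derivative 1) (at a0)" by (rule DERIV_ident)
  qed (use a0 H(3) limit_angle_has_derivative[OF a0] in auto)
  obtain U V g where g: "open U" "U \<subseteq> W" "(of_real a0, 0) \<in> U" "open V"
    "(H (of_real a0, 0), 0) \<in> V" "holo2 g V"
    "\<And>z w. (z, w) \<in> U \<Longrightarrow> (H (z, w), w) \<in> V \<and> g (H (z, w), w) = z"
    "\<And>v w. (v, w) \<in> V \<Longrightarrow> (g (v, w), w) \<in> U \<and> H (g (v, w), w) = v"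
    using holo2_inverse[OF H(1,2,3) nz] by metis
  define M where "M = N \<inter> ?e -` U \<inter> {0<..} \<times> UNIV"
  have "open M" unfolding M_def
    by (intro open_Int N open_vimage g continuous_on_complex_of_real_pair open_Times) auto
  moreover have "(a0, 0) \<in> M" using N g(3) a0 by (simp add: M_def)
  ultimately obtain X Y where XY: "open X" "open Y" "(a0, 0) \<in> X \<times> Y" "X \<times> Y \<subseteq> M"
    using open_prod_elim by metis
  \<comment> \<open>A closed ball, because \<open>T\<close> is evaluated on the edges a0 - \<eta>
    and a0 + \<eta> as well.\<close>
  obtain \<eta> where eta: "\<eta> > 0" "cball a0 \<eta> \<subseteq> X" using XY open_contains_cball by blast
  obtain \<epsilon>1 where e1: "\<epsilon>1 > 0" "ball 0 \<epsilon>1 \<subseteq> Y" using XY open_contains_ball by blast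
  have box: "(a, s) \<in> M" if "\<bar>a - a0\<bar> \<le> \<eta>" "\<bar>s\<bar> < \<epsilon>1" for a s
  proof -
    have "a \<in> X" using eta that by (auto simp: dist_real_def)
    moreover have "s \<in> Y" using e1 that by (auto simp: dist_real_def)
    ultimately show ?thesis using XY by auto
  qed
  have boxW: "(a, s) \<in> ?e -` W" if "\<bar>a - a0\<bar> \<le> \<eta>" "\<bar>s\<bar> < \<epsilon>1" for a s
    using box[OF that] g(2) by (auto simp: M_def)
  have sec: "open {s. \<bar>s\<bar> < \<epsilon>1 \<and> T a s \<in> Z}" if "\<bar>a - a0\<bar> \<le> \<eta>" "open Z" for a and Z :: "real set"
  proof -
    have "continuous_on (ball 0 \<epsilon>1) (\<lambda>s. T (fst (a, s)) (snd (a, s)))"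
      by (rule continuous_on_compose2[OF cT]) (use boxW[OF that(1)] in \<open>auto intro!: continuous_intros simp: dist_real_def\<close>)
    then have "open (ball 0 \<epsilon>1 \<inter> (\<lambda>s. T a s) -` Z)"
      using that by (intro continuous_open_preimage) auto
    moreover have "ball 0 \<epsilon>1 \<inter> (\<lambda>s. T a s) -` Z = {s. \<bar>s\<bar> < \<epsilon>1 \<and> T a s \<in> Z}"
      by (auto simp: dist_real_def)
    ultimately show ?thesis by simp
  qed
  have pos: "a0 - \<eta> > 0" using box[of "a0 - \<eta>" 0] eta e1 by (simp add: M_def)
  have ends: "T (a0 - \<eta>) 0 > c" "T (a0 + \<eta>) 0 < c"
    using limit_angle_strict_decreasing[of "a0 - \<eta>" a0] limit_angle_strict_decreasing[of a0 "a0 + \<eta>"]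
      pos a0 eta T0[of "a0 - \<eta>"] T0[of a0] T0[of "a0 + \<eta>"] by (simp_all add: c_def)
  define VS where "VS = (\<lambda>w. (complex_of_real c, w)) -` V"
  have oVS: "open VS" unfolding VS_def by (intro open_vimage g continuous_intros)
  \<comment> \<open>For small \<open>s\<close> the strict inequalities on the two edges persist by
    continuity, and (c, s) stays in the domain of \<open>g\<close>.\<close>
  define Q where "Q = {s. \<bar>s\<bar> < \<epsilon>1 \<and> T (a0 - \<eta>) s \<in> {c<..}} \<inter> {s. \<bar>s\<bar> < \<epsilon>1 \<and> T (a0 + \<eta>) s \<in> {..<c}}
      \<inter> complex_of_real -` VS"
  have "open Q" unfolding Q_def
    using eta by (intro open_Int sec open_vimage oVS continuous_intros) auto
  moreover have "0 \<in> Q" using e1 ends g(5) by (simp add: Q_def VS_def Hc)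
  ultimately obtain \<epsilon> where eps: "\<epsilon> > 0" "ball 0 \<epsilon> \<subseteq> Q" using open_contains_ball by blast
  have Qs: "\<bar>s\<bar> < \<epsilon>1" "T (a0 - \<eta>) s > c" "T (a0 + \<eta>) s < c" "of_real s \<in> VS"
    if "s \<in> {-\<epsilon><..<\<epsilon>}" for s
  proof -
    have "s \<in> Q" using that eps(2) by (auto simp: dist_real_def subset_iff)
    then show "\<bar>s\<bar> < \<epsilon>1" "T (a0 - \<eta>) s > c" "T (a0 + \<eta>) s < c" "of_real s \<in> VS"
      by (auto simp: Q_def)
  qed
  define A where "A s = Re (g (of_real c, of_real s))" for s :: real
  have uniq: "a = A s" if "\<bar>a - a0\<bar> \<le> \<eta>" "\<bar>s\<bar> < \<epsilon>1" "T a s = c" for a s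
  proof -
    have "(of_real a, of_real s) \<in> U" using box[OF that(1,2)] by (simp add: M_def)
    then have "g (of_real c, of_real s) = of_real a"
      using g(7)[of "of_real a" "of_real s"] Hr[of a s] g(2) that(3) by auto
    then show ?thesis by (simp add: A_def)
  qed
  \<comment> \<open>It is not known beforehand that \<open>g (of_real c, of_real s)\<close> is real.
    The sign change between the edges yields a real solution \<open>a\<close>, and
    \<open>uniq\<close> identifies it with \<open>A s\<close>.\<close>
  have ex: "A s \<in> {a0 - \<eta><..<a0 + \<eta>} \<and> T (A s) s = c" if s: "s \<in> {-\<epsilon><..<\<epsilon>}" for s
  proof -
    have "continuous_on {a0 - \<eta>..a0 + \<eta>} (\<lambda>a. T (fst (a, s)) (snd (a, s)))"
      by (rule continuous_on_compose2[OF cT])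
        (use boxW[OF _ Qs(1)[OF s]] in \<open>auto intro!: continuous_intros simp: abs_le_iff\<close>)
    then have "continuous_on {a0 - \<eta>..a0 + \<eta>} (\<lambda>a. T a s)" by simp
    then obtain a where a: "a0 - \<eta> \<le> a" "a \<le> a0 + \<eta>" "T a s = c"
      using IVT2'[of "\<lambda>a. T a s" "a0 + \<eta>" c "a0 - \<eta>"] Qs(2,3)[OF s] eta by auto
    have "a = A s" by (rule uniq) (use a Qs(1)[OF s] in auto)
    moreover have "a \<noteq> a0 - \<eta>" "a \<noteq> a0 + \<eta>" using a(3) Qs(2,3)[OF s] by auto
    ultimately show ?thesis using a by auto
  qed
  show ?thesis
  proof (rule that[OF eta(1) eps(1)])
    show "{a0 - \<eta><..<a0 + \<eta>} \<times> {-\<epsilon><..<\<epsilon>} \<subseteq> N"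
      using box Qs(1) by (fastforce simp: M_def)
    have "(\<lambda>w. g (of_real c, w)) holomorphic_on VS"
      unfolding holomorphic_on_open[OF oVS]
    proof
      fix w assume "w \<in> VS"
      then have "(of_real c, w) \<in> V" by (simp add: VS_def)
      from has_derivative_imp_partial_derivs(2)[OF holo2_has_derivative[OF g(6) this]]
      show "\<exists>f'. ((\<lambda>w. g (of_real c, w)) has_field_derivative f') (at w)" by blast
    qed
    then show "real_analytic_on A {-\<epsilon><..<\<epsilon>}"
      unfolding A_def by (rule real_analytic_on_Re_holomorphic[OF _ oVS Qs(4)])
    show "A 0 = a0" using uniq[of a0 0] eta e1 by (simp add: c_def)
    show "A s \<in> {a0 - \<eta><..<a0 + \<eta>}" if "s \<in> {-\<epsilon><..<\<epsilon>}" for s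
      using ex[OF that] by blast
    show "T a s = T a0 0 \<longleftrightarrow> a = A s" if "a \<in> {a0 - \<eta><..<a0 + \<eta>}" "s \<in> {-\<epsilon><..<\<epsilon>}" for a s
      using ex[OF that(2)] uniq[of a s] Qs(1)[OF that(2)] that(1)
      by (auto simp: c_def[symmetric] abs_le_iff)
  qed
qed

theorem proposition3p7:
  fixes \<beta> :: "real \<Rightarrow> real \<Rightarrow> real"
    and \<gamma> :: "real \<Rightarrow> real \<Rightarrow> real \<Rightarrow> real ^ 2"
    and k :: nat
  assumes beta_analytic: "real_analytic2_on (\<lambda>(a, s). \<beta> a s) param_domain"
    and beta_bij: "\<And>a. a > 0 \<Longrightarrow> bij_betw (\<beta> a) {-1<..<1} {0<..<L_len a}"
    and beta_deriv: "\<And>a s. a > 0 \<Longrightarrow> s \<in> {-1<..<1} \<Longrightarrow> deriv (\<beta> a) s > 0"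
    and beta_zero: "\<And>a. a > 0 \<Longrightarrow> \<beta> a 0 = rho_zero a"
    and geodesic: "\<And>a s. a > 0 \<Longrightarrow> s \<in> {-1<..<1} \<Longrightarrow>
          geodesic_on (Omega_metric a) (polar_domain a) UNIV (\<gamma> a s)"
    and initial_point: "\<And>a s. a > 0 \<Longrightarrow> s \<in> {-1<..<1} \<Longrightarrow> \<gamma> a s 0 = vector [\<beta> a s, 0]"
    and initial_velocity: "\<And>a s. a > 0 \<Longrightarrow> s \<in> {-1<..<1} \<Longrightarrow>
          (\<gamma> a s has_vector_derivative vector [0, 1]) (at 0)"
    and k: "k \<ge> 1"
  shows "(\<forall>j. 0 < j \<and> j < 2 * k \<longrightarrow>
            (\<exists>U \<epsilon> A S. open U \<and> U \<subseteq> param_domain \<and> (a_bif k j, 0) \<in> U \<and> \<epsilon> > 0 \<and>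
               real_analytic_on A {-\<epsilon><..<\<epsilon>} \<and> real_analytic_on S {-\<epsilon><..<\<epsilon>} \<and>
               (\<forall>t\<in>{-\<epsilon><..<\<epsilon>}. (A t, S t) \<in> U) \<and>
               A 0 = a_bif k j \<and> S 0 = 0 \<and> deriv S 0 > 0 \<and>
               f_zeros \<gamma> k \<inter> U = (B_triv \<inter> U) \<union> {(A t, S t) | t. t \<in> {-\<epsilon><..<\<epsilon>}})) \<and>
         (\<forall>a>0. (\<forall>j. 0 < j \<and> j < 2 * k \<longrightarrow> a \<noteq> a_bif k j) \<longrightarrow>
            (\<exists>V. open V \<and> V \<subseteq> param_domain \<and> (a, 0) \<in> V \<and>
               f_zeros \<gamma> k \<inter> V = B_triv \<inter> V))"
proof -
  have range: "\<beta> a s \<in> {0<..<L_len a}" if "(a, s) \<in> param_domain" for a s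
    using bij_betwE[OF beta_bij[of a]] that by (auto simp: param_domain_def)
  let ?T = "turn_angle \<beta>"
  have T0: "?T a 0 = pi * sqrt (1 + a\<^sup>2) / (2 * a)" if "a > 0" for a
    by (rule turn_angle_0) (use that beta_zero in auto)
  have angle: "0 < phi_of a (\<beta> a s)" "phi_of a (\<beta> a s) < pi / 2" "rho_of a (phi_of a (\<beta> a s)) = \<beta> a s"
    if "(a, s) \<in> param_domain" for a s
    using polar_angle_exists[of a "\<beta> a s"] range[OF that] that
    by (auto simp: param_domain_def elim: meta_mp)
  have zeros: "(a, s) \<in> f_zeros \<gamma> k \<longleftrightarrow> s = 0 \<or> (\<exists>j\<ge>1. real j * ?T a s = real k * pi)"
    if as: "(a, s) \<in> param_domain" for a s
  proof -
    have dom: "a > 0" "s \<in> {-1<..<1}" using as by (auto simp: param_domain_def)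
    \<comment> \<open>The condition m = 0 in the zero criterion is the trivial branch: the cosine is
      injective on [0, pi], and \<beta> a takes the value \<open>rho_zero a\<close> only at
      0.\<close>
    have "cos (2 * phi_of a (\<beta> a s)) = 0 \<longleftrightarrow> s = 0"
    proof
      assume "s = 0"
      then show "cos (2 * phi_of a (\<beta> a s)) = 0"
        using dom by (simp add: beta_zero rho_zero_eq phi_of_rho_of)
    next
      assume "cos (2 * phi_of a (\<beta> a s)) = 0"
      then have "cos (2 * phi_of a (\<beta> a s)) = cos (pi / 2)" by simp
      then have "2 * phi_of a (\<beta> a s) = pi / 2"
        using cos_inj_pi[of "2 * phi_of a (\<beta> a s)" "pi / 2"] angle(1,2)[OF as] by linarith
      then have "phi_of a (\<beta> a s) = pi / 4" by simp
      then have "\<beta> a s = \<beta> a 0"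
        using angle(3)[OF as] beta_zero[OF dom(1)] rho_zero_eq[OF dom(1)] by metis
      then show "s = 0"
        using bij_betw_imp_inj_on[OF beta_bij[OF dom(1)]] dom(2) by (auto dest: inj_onD)
    qed
    then show ?thesis
      using f_map_zero_iff[where \<gamma> = \<gamma> and a = a and s = s, OF dom(1) geodesic[OF dom] initial_point[OF dom] initial_velocity[OF dom] k] as
      by (simp add: f_zeros_def turn_angle_def)
  qed
  let ?e = "\<lambda>p. (complex_of_real (fst p), complex_of_real (snd p))"
  \<comment> \<open>For s \<noteq> 0 a zero means that the quotient k pi / \<Theta> is a positive
    integer. Its continuity reduces both claims to asking which integers lie near its value at (a0,
    0).\<close>
  have local: "\<exists>H W. open W \<and> (of_real a0, 0) \<in> W \<and> holo2 H W \<and>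
      (\<forall>a s. (of_real a, of_real s) \<in> W \<longrightarrow> (a, s) \<in> param_domain \<and> H (of_real a, of_real s) = of_real (?T a s)) \<and>
      open (?e -` W) \<and> continuous_on (?e -` W) (\<lambda>p. real k * pi / ?T (fst p) (snd p))"
    if a0: "a0 > 0" for a0
  proof -
    obtain H W where H: "open W" "(of_real a0, 0) \<in> W" "holo2 H W"
      "\<And>a s. (of_real a, of_real s) \<in> W \<Longrightarrow>
         (a, s) \<in> param_domain \<and> H (of_real a, of_real s) = of_real (?T a s)"
      using turn_angle_complex_extension[OF beta_analytic range beta_zero a0] by metis
    have "continuous_on (?e -` W) (\<lambda>p. Re (H (?e p)))"
      by (rule continuous_on_Re, rule continuous_on_compose2[OF holo2_imp_continuous_on[OF H(3)]],
          rule continuous_on_complex_of_real_pair) auto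
    then have "continuous_on (?e -` W) (\<lambda>p. ?T (fst p) (snd p))"
      by (rule continuous_on_eq) (auto simp: H(4))
    moreover have "?T (fst p) (snd p) \<noteq> 0" if "p \<in> ?e -` W" for p
    proof -
      have p: "(fst p, snd p) \<in> param_domain" using H(4)[of "fst p" "snd p"] that by auto
      then have a: "fst p > 0" by (auto simp: param_domain_def)
      define m where "m = cos (2 * phi_of (fst p) (\<beta> (fst p) (snd p)))"
      have "sin (2 * phi_of (fst p) (\<beta> (fst p) (snd p))) > 0"
        using angle[OF p] by (intro sin_gt_zero) auto
      then have "m\<^sup>2 < 1" unfolding m_def cos_squared_eq by simp
      then have m: "\<bar>m\<bar> < 1" by (simp add: abs_square_less_1)
      have "half_period_angle (fst p) m > 0" by (rule half_period_angle_pos[OF a m])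
      then show ?thesis by (simp add: turn_angle_def m_def)
    qed
    ultimately have "continuous_on (?e -` W) (\<lambda>p. real k * pi / ?T (fst p) (snd p))"
      by (intro continuous_intros) auto
    moreover have "open (?e -` W)"
      by (intro open_vimage H continuous_on_complex_of_real_pair)
    ultimately show ?thesis using H by blast
  qed
  have T_nz: "?T a s \<noteq> 0" if "real j * ?T a s = real k * pi" for a s j
    using that k by auto
  show ?thesis
  proof (intro conjI allI impI)
    fix j assume j: "0 < j \<and> j < 2 * k"
    define a0 where "a0 = a_bif k j"
    have a0: "a0 > 0" using a_bif_pos j by (simp add: a0_def)
    have Ta0: "real j * ?T a0 0 = real k * pi"
      using a_bif_iff[OF a0 k, of j] j T0[OF a0] by (simp add: a0_def)
    obtain H W where H: "open W" "(of_real a0, 0) \<in> W" "holo2 H W"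
      and Hr: "\<forall>a s. (of_real a, of_real s) \<in> W \<longrightarrow>
         (a, s) \<in> param_domain \<and> H (of_real a, of_real s) = of_real (?T a s)"
      and oW: "open (?e -` W)" and cW: "continuous_on (?e -` W) (\<lambda>p. real k * pi / ?T (fst p) (snd p))"
      using local[OF a0] by (elim exE conjE) (rule that; assumption)
    \<comment> \<open>On \<open>N\<close> the quotient differs from \<open>j\<close> by less than 1,
      so \<open>j\<close> is the only integer it can equal.\<close>
    define N where "N = ?e -` W \<inter> (\<lambda>p. real k * pi / ?T (fst p) (snd p)) -` ball (real j) 1"
    have N: "open N" unfolding N_def by (rule continuous_open_preimage[OF cW oW open_ball])
    have N0: "(a0, 0) \<in> N"
      using H(2) T_nz[OF Ta0] by (simp add: N_def flip: Ta0)
    obtain \<eta> \<epsilon> A where A: "\<eta> > 0" "\<epsilon> > 0" "{a0 - \<eta><..<a0 + \<eta>} \<times> {-\<epsilon><..<\<epsilon>} \<subseteq> N"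
      "real_analytic_on A {-\<epsilon><..<\<epsilon>}" "A 0 = a0"
      "\<And>s. s \<in> {-\<epsilon><..<\<epsilon>} \<Longrightarrow> A s \<in> {a0 - \<eta><..<a0 + \<eta>}"
      "\<And>a s. a \<in> {a0 - \<eta><..<a0 + \<eta>} \<Longrightarrow> s \<in> {-\<epsilon><..<\<epsilon>} \<Longrightarrow> ?T a s = ?T a0 0 \<longleftrightarrow> a = A s"
    proof (rule turn_angle_implicit[where T = ?T, OF H(3,1,2) _ T0 a0 N N0])
      show "H (of_real a, of_real s) = of_real (?T a s)" if "(of_real a, of_real s) \<in> W" for a s
        using Hr that by blast
    qed (assumption | rule that)+
    define U where "U = {a0 - \<eta><..<a0 + \<eta>} \<times> {-\<epsilon><..<\<epsilon>}"
    have UN: "(a, s) \<in> param_domain" "\<bar>real k * pi / ?T a s - real j\<bar> < 1" if "(a, s) \<in> U" for a s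
    proof -
      have "(a, s) \<in> N" using that A(3) unfolding U_def by blast
      then show "(a, s) \<in> param_domain" "\<bar>real k * pi / ?T a s - real j\<bar> < 1"
        using Hr[rule_format, of a s] by (auto simp: N_def dist_real_def abs_minus_commute)
    qed
    have crit: "(\<exists>i\<ge>1. real i * ?T a s = real k * pi) \<longleftrightarrow> a = A s" if as: "(a, s) \<in> U" for a s
    proof -
      have "real j * ?T a s = real k * pi \<longleftrightarrow> ?T a s = ?T a0 0"
        unfolding Ta0[symmetric] using j by simp
      also have "\<dots> \<longleftrightarrow> a = A s"
        using A(7)[of a s] as by (simp add: U_def)
      finally have j_iff: "real j * ?T a s = real k * pi \<longleftrightarrow> a = A s" .
      have only_j: "i = j" if i: "real i * ?T a s = real k * pi" for i
      proof -
        have "real k * pi / ?T a s = real i" using T_nz[OF i] by (simp flip: i)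
        then have "\<bar>real i - real j\<bar> < 1" using UN(2)[OF as] by simp
        then show ?thesis by linarith
      qed
      have "j \<ge> 1" using j by simp
      then show ?thesis using only_j unfolding j_iff[symmetric] by blast
    qed
    show "\<exists>U \<epsilon> A S. open U \<and> U \<subseteq> param_domain \<and> (a_bif k j, 0) \<in> U \<and> \<epsilon> > 0 \<and>
               real_analytic_on A {-\<epsilon><..<\<epsilon>} \<and> real_analytic_on S {-\<epsilon><..<\<epsilon>} \<and>
               (\<forall>t\<in>{-\<epsilon><..<\<epsilon>}. (A t, S t) \<in> U) \<and>
               A 0 = a_bif k j \<and> S 0 = 0 \<and> deriv S 0 > 0 \<and>
               f_zeros \<gamma> k \<inter> U = (B_triv \<inter> U) \<union> {(A t, S t) | t. t \<in> {-\<epsilon><..<\<epsilon>}}"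
    \<comment> \<open>The branch is a graph over \<open>s\<close>, so \<open>s\<close> itself serves
      as the curve parameter and the second component has derivative 1.\<close>
    proof (rule exI[of _ U], rule exI[of _ \<epsilon>], rule exI[of _ A], rule exI[of _ "\<lambda>t. t"], intro conjI)
      show "open U" unfolding U_def by (intro open_Times) auto
      show "U \<subseteq> param_domain" using UN(1) by auto
      show "(a_bif k j, 0) \<in> U" using A(1,2) by (simp add: U_def a0_def)
      show "real_analytic_on (\<lambda>t. t) {-\<epsilon><..<\<epsilon>}"
        using real_analytic_on_Re_holomorphic[of "\<lambda>z. z" UNIV "{-\<epsilon><..<\<epsilon>}"] by simp
      show "A 0 = a_bif k j" using A(5) by (simp add: a0_def)
      show inU: "\<forall>t\<in>{-\<epsilon><..<\<epsilon>}. (A t, t) \<in> U" using A(6) by (auto simp: U_def)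
      have "(a, s) \<in> f_zeros \<gamma> k \<longleftrightarrow> (a, s) \<in> B_triv \<union> {(A t, t) | t. t \<in> {-\<epsilon><..<\<epsilon>}}"
        if as: "(a, s) \<in> U" for a s
      proof -
        have "a > 0" "s \<in> {-\<epsilon><..<\<epsilon>}" using UN(1)[OF as] as by (auto simp: param_domain_def U_def)
        then show ?thesis
          unfolding zeros[OF UN(1)[OF as]] crit[OF as] by (auto simp: B_triv_def)
      qed
      then show "f_zeros \<gamma> k \<inter> U = (B_triv \<inter> U) \<union> {(A t, t) | t. t \<in> {-\<epsilon><..<\<epsilon>}}"
        using inU by auto
    qed (use A in auto)
  next
    fix a0 :: real assume a0: "a0 > 0" and ne: "\<forall>j. 0 < j \<and> j < 2 * k \<longrightarrow> a0 \<noteq> a_bif k j"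
    obtain H W where H: "(of_real a0, 0) \<in> W" "holo2 H W"
      and Hr: "\<forall>a s. (of_real a, of_real s) \<in> W \<longrightarrow>
         (a, s) \<in> param_domain \<and> H (of_real a, of_real s) = of_real (?T a s)"
      and oW: "open (?e -` W)" and cW: "continuous_on (?e -` W) (\<lambda>p. real k * pi / ?T (fst p) (snd p))"
      using local[OF a0] by (elim exE conjE) (rule that; assumption)
    \<comment> \<open>At a non-bifurcation value the quotient is not an integer, and the integers
      form a closed set, so this persists nearby.\<close>
    define V where "V = ?e -` W \<inter> (\<lambda>p. real k * pi / ?T (fst p) (snd p)) -` (- \<int>)"
    have V0: "(a0, 0) \<in> V"
    proof -
      have "real k * pi / ?T a0 0 \<notin> \<int>"
      proof
        assume "real k * pi / ?T a0 0 \<in> \<int>"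
        then obtain i :: int where i: "real k * pi / ?T a0 0 = of_int i" by (auto elim: Ints_cases)
        have Tpos: "?T a0 0 > 0" unfolding T0[OF a0] using a0 by (simp add: add_pos_nonneg)
        then have "real k * pi / ?T a0 0 > 0" using k by simp
        then have ip: "i > 0" unfolding i by simp
        have "real (nat i) * ?T a0 0 = real k * pi"
          using i ip Tpos by (simp add: field_simps)
        then have "nat i < 2 * k \<and> a0 = a_bif k (nat i)"
          using a_bif_iff[OF a0 k, of "nat i"] ip unfolding T0[OF a0] by simp
        then show False using ne[rule_format, of "nat i"] ip by simp
      qed
      then show ?thesis using H(1) by (simp add: V_def)
    qed
    have dom: "(a, s) \<in> param_domain" "\<nexists>i. real i * ?T a s = real k * pi" if "(a, s) \<in> V" for a s
    proof -
      show "(a, s) \<in> param_domain" using Hr[rule_format, of a s] that by (simp add: V_def)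
      show "\<nexists>i. real i * ?T a s = real k * pi"
      proof
        assume "\<exists>i. real i * ?T a s = real k * pi"
        then obtain i where i: "real i * ?T a s = real k * pi" by blast
        have "real k * pi / ?T a s = real i" using T_nz[OF i] by (simp flip: i)
        then show False using that by (simp add: V_def)
      qed
    qed
    show "\<exists>V. open V \<and> V \<subseteq> param_domain \<and> (a0, 0) \<in> V \<and> f_zeros \<gamma> k \<inter> V = B_triv \<inter> V"
    proof (intro exI[of _ V] conjI V0)
      show "open V" unfolding V_def by (intro continuous_open_preimage[OF cW oW] open_Compl closed_Ints)
      show "V \<subseteq> param_domain" using dom(1) by auto
      have "(a, s) \<in> f_zeros \<gamma> k \<longleftrightarrow> (a, s) \<in> B_triv" if "(a, s) \<in> V" for a s
        using zeros[OF dom(1)[OF that]] dom[OF that] by (auto simp: B_triv_def param_domain_def)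
      then show "f_zeros \<gamma> k \<inter> V = B_triv \<inter> V" by auto
    qed
  qed
qed

end
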